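(* Let $\mathcal{M}\subset\mathbb{R}^d$ be a surface satisfying Condition (I) below, with convex domain $\mathcal{U}\subset\mathbb{R}^k$ and isometry $\phi$, $\phi(\mathcal{U})=\mathcal{M}$. There is a constant $C>0$ depending only on $\mathcal{M}$ such that, if $0<\varepsilon\le1/C$, then for every finite $\varepsilon$-covering $\mathbf{X}=\{x_1,\dots,x_n\}\subset\mathcal{M}$ of $\mathcal{M}$, every surface $\hat{\mathcal{M}}\in\mathbb{M}$ with $\rho(\hat{\mathcal{M}})\ge\rho_{\max}/2$ and $\alpha(\hat{\mathcal{M}})\ge\alpha_{\max}/2$, and every convex domain $\hat{\mathcal{U}}$ and isometry $\hat\phi$ with $\hat\phi(\hat{\mathcal{U}})=\hat{\mathcal{M}}$ as in Condition (I), the embedding $\hat u_i:=\hat\phi^{-1}(x_i)$, $i\in[n]$, satisfies $$\min_{Q\in\mathbb{Q}_k}\ \max_{i\in[n]}\ \|\hat u_i-Q(u_i)\|\le C\varepsilon^2,\qquad\text{where } u_i:=\phi^{-1}(x_i).$$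
   Context: Condition (I): there is a compact and convex domain with non-empty interior in $\mathbb{R}^k$ and a $C^2$ isometry defined on an open set containing that domain such that the surface is the image of that domain by that isometry. Here isometry means that the Euclidean distance on the convex domain corresponds to the intrinsic distance (infimum of lengths of curves on the surface) on its image. $\mathbb{Q}_k$ is the class of rigid transformations of $\mathbb{R}^k$ (orthogonal transformations composed with translations); $[n]=\{1,\dots,n\}$. A finite set $\mathbf{X}\subset\mathcal{S}$ is an $\varepsilon$-covering of $\mathcal{S}$ if $\max_{x\in\mathcal{S}}\min_i\|x-x_i\|\le\varepsilon$. The reach $\rho(\mathcal{S})$ is the infimum of the distances between a point of $\mathcal{S}$ and a point of $\mathbb{R}^d$ having two or more closest points on $\mathcal{S}$. For a surface $\mathcal{S}$ satisfying Condition (I), with tangent space $T_{\mathcal{S}}(x)$ at $x\in\mathcal{S}$, $\alpha(\mathcal{S})$ denotes the largest (supremum) $\alpha>0$ such that, for each $x\in\mathcal{S}$ and each $h\le\alpha$, the orthogonal projection of $B(x,h)\cap\mathcal{S}$ onto $T_{\mathcal{S}}(x)$ contains a cone of the form $\{t\in T_{\mathcal{S}}(x)\cap B(x,\alpha h):\angle(t-x,u)\le\alpha\}$ for some unit vector $u$. $\mathbb{M}=\mathbb{M}(k,\mathbf{X},\varepsilon)$ is the class of surfaces in $\mathbb{R}^d$ satisfying Condition (I) (with the given $k$), containing $\mathbf{X}$, and for which $\mathbf{X}$ is an $\varepsilon$-covering; it contains $\mathcal{M}$. $\rho_{\max}$ is the supremum of the reach over $\mathbb{M}$, and $\alpha_{\max}$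 is the supremum of $\alpha(\mathcal{S})$ over those $\mathcal{S}\in\mathbb{M}$ with reach at least $\rho_{\max}/2$. *)

theory Defs
  imports "HOL-Analysis.Analysis"
begin

definition curve_length :: "(real \<Rightarrow> 'a::metric_space) \<Rightarrow> ennreal" where
  "curve_length \<gamma> =
     (SUP (n, t) \<in> {(n::nat, t). mono_on {..n} t \<and> t ` {..n} \<subseteq> {0..1}}.
        \<Sum>i<n. ennreal (dist (\<gamma> (t i)) (\<gamma> (t (Suc i)))))"

(* The value is top if no curve in S of finite length joins x to y. *)
definition intrinsic_dist :: "'a::metric_space set \<Rightarrow> 'a \<Rightarrow> 'a \<Rightarrow> ennreal" where
  "intrinsic_dist S x y =
     (INF \<gamma> \<in> {\<gamma>. path \<gamma> \<and> path_image \<gamma> \<subseteq> S \<and> pathstart \<gamma> = x \<and> pathfinish \<gamma> = y}.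
        curve_length \<gamma>)"

definition C2_on :: "'a::real_normed_vector set \<Rightarrow> ('a \<Rightarrow> 'b::real_normed_vector) \<Rightarrow> bool" where
  "C2_on W f \<longleftrightarrow>
     (\<exists>(f' :: 'a \<Rightarrow> ('a \<Rightarrow>\<^sub>L 'b)) (f'' :: 'a \<Rightarrow> ('a \<Rightarrow>\<^sub>L ('a \<Rightarrow>\<^sub>L 'b))).
        (\<forall>x\<in>W. (f has_derivative blinfun_apply (f' x)) (at x)) \<and>
        (\<forall>x\<in>W. (f' has_derivative blinfun_apply (f'' x)) (at x)) \<and>
        continuous_on W f'')"

(* Smoothness is required on an open neighbourhood of the convex domain U; the isometry
   property is a property of U and its image S. *)
definition isometric_chart ::
    "(real^'k) set \<Rightarrow> (real^'k \<Rightarrow> real^'d) \<Rightarrow> (real^'d) set \<Rightarrow> bool" where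
  "isometric_chart U \<phi> S \<longleftrightarrow>
     compact U \<and> convex U \<and> interior U \<noteq> {} \<and>
     (\<exists>W. open W \<and> U \<subseteq> W \<and> C2_on W \<phi>) \<and>
     \<phi> ` U = S \<and>
     (\<forall>u\<in>U. \<forall>v\<in>U. intrinsic_dist S (\<phi> u) (\<phi> v) = ennreal (dist u v))"

definition condition_I :: "'k::finite itself \<Rightarrow> (real^'d) set \<Rightarrow> bool" where
  "condition_I _ S \<longleftrightarrow> (\<exists>U (\<phi> :: real^'k \<Rightarrow> real^'d). isometric_chart U \<phi> S)"

definition rigid_transformations :: "(real^'k \<Rightarrow> real^'k) set" where
  "rigid_transformations = {\<lambda>u. f u + b | f b. orthogonal_transformation f}"

definition eps_covering :: "real \<Rightarrow> 'a::metric_space set \<Rightarrow> 'a set \<Rightarrow> bool" where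
  "eps_covering \<epsilon> X S \<longleftrightarrow> finite X \<and> X \<subseteq> S \<and> (\<forall>x\<in>S. \<exists>y\<in>X. dist x y \<le> \<epsilon>)"

definition closest_points :: "'a::metric_space set \<Rightarrow> 'a \<Rightarrow> 'a set" where
  "closest_points S z = {y \<in> S. \<forall>w\<in>S. dist z y \<le> dist z w}"

(* The value is top if no point has two closest points, e.g. if S is flat and convex. *)
definition reach :: "'a::metric_space set \<Rightarrow> ennreal" where
  "reach S =
     (INF (x, z) \<in> {(x, z). x \<in> S \<and> (\<exists>y\<in>closest_points S z. \<exists>y'\<in>closest_points S z. y \<noteq> y')}.
        ennreal (dist x z))"

(* The tangent space is affine (it passes through x). Initial velocities of curves in S
   issued from x form only a cone when x is a boundary point of S; for S satisfying
   Condition (I), their span is the range of the differential of the isometry at the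
   preimage of x. *)
definition tangent_space :: "'a::real_normed_vector set \<Rightarrow> 'a \<Rightarrow> 'a set" where
  "tangent_space S x =
     (\<lambda>v. x + v) ` span {v. \<exists>\<gamma>. path \<gamma> \<and> path_image \<gamma> \<subseteq> S \<and> pathstart \<gamma> = x \<and>
                              (\<gamma> has_vector_derivative v) (at 0 within {0..1})}"

definition orthogonal_projection_image ::
    "'a::real_inner set \<Rightarrow> 'a set \<Rightarrow> 'a set" where
  "orthogonal_projection_image T A = {t \<in> T. \<exists>p\<in>A. \<forall>w\<in>T. (p - t) \<bullet> (w - t) = 0}"

(* Cone in the affine space T with apex x, axis u, radius r and half-angle a. The apex,
   where the angle is undefined, is included. *)
definition tangent_cone ::
    "'a::real_inner set \<Rightarrow> 'a \<Rightarrow> 'a \<Rightarrow> real \<Rightarrow> real \<Rightarrow> 'a set" where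
  "tangent_cone T x u r a =
     {t \<in> T \<inter> ball x r. t = x \<or> arccos (((t - x) \<bullet> u) / (norm (t - x) * norm u)) \<le> a}"

(* The axis u is required to be a tangent direction: for u normal to the surface the cone
   could degenerate to its apex and the condition would be void. *)
definition cone_condition :: "'a::real_inner set \<Rightarrow> real \<Rightarrow> bool" where
  "cone_condition S a \<longleftrightarrow>
     (\<forall>x\<in>S. \<forall>h. 0 < h \<and> h \<le> a \<longrightarrow>
        (\<exists>u. norm u = 1 \<and> x + u \<in> tangent_space S x \<and>
           tangent_cone (tangent_space S x) x u (a * h) a
             \<subseteq> orthogonal_projection_image (tangent_space S x) (ball x h \<inter> S)))"

definition cone_constant :: "'a::real_inner set \<Rightarrow> ennreal" where
  "cone_constant S = (SUP a \<in> {a::real. 0 < a \<and> cone_condition S a}. ennreal a)"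

definition surface_class ::
    "'k::finite itself \<Rightarrow> (real^'d) set \<Rightarrow> real \<Rightarrow> (real^'d) set set" where
  "surface_class K X \<epsilon> = {S. condition_I K S \<and> X \<subseteq> S \<and> eps_covering \<epsilon> X S}"

definition reach_max :: "'k::finite itself \<Rightarrow> (real^'d) set \<Rightarrow> real \<Rightarrow> ennreal" where
  "reach_max K X \<epsilon> = (SUP S \<in> surface_class K X \<epsilon>. reach S)"

definition cone_max :: "'k::finite itself \<Rightarrow> (real^'d) set \<Rightarrow> real \<Rightarrow> ennreal" where
  "cone_max K X \<epsilon> =
     (SUP S \<in> {S \<in> surface_class K X \<epsilon>. reach S \<ge> reach_max K X \<epsilon> / 2}. cone_constant S)"

end

theory Submission
  imports Defs
begin

text \<open>Send a point \<open>z\<close> of \<open>M\<close> to a nearest point \<open>a\<close> of \<open>M'\<close>. Since both surfaces contain the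
  \<open>\<epsilon>\<close>-net \<open>X\<close>, which near every point contains well-conditioned frames of size of order \<open>\<epsilon>\<close>, the
  component of \<open>z - a\<close> normal to \<open>M'\<close> at \<open>a\<close> is \<open>O(\<epsilon>\<^sup>2)\<close>, although near the boundary \<open>z - a\<close> itself
  may be of order \<open>\<epsilon>\<close>. The tangential component points out of \<open>M'\<close> and, second derivatives of an
  isometric chart being normal, does not affect the Lipschitz constant. Hence nearest-point
  projection stretches lengths by at most \<open>1 + O(\<epsilon>\<^sup>2)\<close>, with a constant governed by the reach.
  Applied in both directions, this shows that the intrinsic distances of the points of \<open>X\<close> on \<open>M\<close>
  and \<open>M'\<close> agree up to \<open>O(\<epsilon>\<^sup>2)\<close>, and a perturbation bound for the Procrustes problem concludes.\<close>

section \<open>Intrinsic distance\<close>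

text \<open>The obstacle is that M' is arbitrary: neither the second derivatives of its chart nor
  the Lipschitz constant of the inverse may enter \<open>C\<close>. The uniform datum is a lower
  bound on the reach, available because M itself competes in \<open>reach_max\<close>. The constants
  \<open>K\<close> and \<open>L\<close> of a chart are therefore used in two ways that leave no
  trace. They give a small ball touching the surface, which the reach enlarges to a radius common to
  both surfaces; and they control the steps of a subdivision whose mesh tends to 0, where they drop
  out of the limit. The frames come from M alone: shrinking a ball inside its convex domain towards
  a given point yields a ball of radius of order \<epsilon> that stays in the domain, even at the
  boundary. The net carries these frames over to M'. In such a frame a vector of length
  O(\<epsilon>) has coordinates O(1), and points of either surface at distance O(\<epsilon>) from a
  base point are within O(\<epsilon>^2) of its tangent space; this is the origin of the
  rate.\<close>

lemma chord_le_curve_length: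
  "ennreal (dist (pathstart \<gamma>) (pathfinish \<gamma>)) \<le> curve_length \<gamma>"
proof -
  have "(1, real) \<in> {(n::nat, t). mono_on {..n} t \<and> t ` {..n} \<subseteq> {0..1}}"
    by (auto simp: mono_on_def)
  then have "(\<Sum>i<(1::nat). ennreal (dist (\<gamma> (real i)) (\<gamma> (real (Suc i))))) \<le> curve_length \<gamma>"
    unfolding curve_length_def by (rule SUP_upper2) simp
  then show ?thesis by (simp add: pathstart_def pathfinish_def)
qed

lemma chord_le_intrinsic_dist: "ennreal (dist x y) \<le> intrinsic_dist S x y"
  unfolding intrinsic_dist_def using chord_le_curve_length by (auto intro!: INF_greatest)

lemma curve_length_le:
  assumes "\<And>s t. 0 \<le> s \<Longrightarrow> s \<le> t \<Longrightarrow> t \<le> 1 \<Longrightarrow> dist (\<gamma> s) (\<gamma> t) \<le> B * (t - s)"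
    and "0 \<le> B"
  shows "curve_length \<gamma> \<le> ennreal B"
  unfolding curve_length_def
proof (rule SUP_least, clarify)
  fix n :: nat and t :: "nat \<Rightarrow> real"
  assume mono: "mono_on {..n} t" and im: "t ` {..n} \<subseteq> {0..1}"
  have "dist (\<gamma> (t i)) (\<gamma> (t (Suc i))) \<le> B * (t (Suc i) - t i)" if "i < n" for i
    using that mono im by (intro assms) (auto simp: mono_on_def image_subset_iff)
  then have "(\<Sum>i<n. dist (\<gamma> (t i)) (\<gamma> (t (Suc i)))) \<le> (\<Sum>i<n. B * (t (Suc i) - t i))"
    by (intro sum_mono) auto
  also have "\<dots> = B * (t n - t 0)"
    by (simp add: sum_distrib_left [symmetric] sum_lessThan_telescope)
  also have "\<dots> \<le> B * 1"
  proof (intro mult_left_mono \<open>0 \<le> B\<close>)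
    have "t n \<in> {0..1}" "t 0 \<in> {0..1}" using im by auto
    then show "t n - t 0 \<le> 1" by simp
  qed
  finally show "(\<Sum>i<n. ennreal (dist (\<gamma> (t i)) (\<gamma> (t (Suc i))))) \<le> ennreal B"
    by (simp add: sum_ennreal ennreal_leI)
qed

lemma intrinsic_dist_le:
  assumes "\<And>s t. 0 \<le> s \<Longrightarrow> s \<le> t \<Longrightarrow> t \<le> 1 \<Longrightarrow> dist (\<gamma> s) (\<gamma> t) \<le> B * (t - s)"
    and "0 \<le> B" "path \<gamma>" "path_image \<gamma> \<subseteq> S"
  shows "intrinsic_dist S (pathstart \<gamma>) (pathfinish \<gamma>) \<le> ennreal B"
  unfolding intrinsic_dist_def
  by (rule INF_lower2[of \<gamma>]) (use assms curve_length_le[of \<gamma> B] in auto)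

text \<open>The second difference of \<open>f\<close> over the parallelogram with sides
  \<open>s *\<^sub>R a\<close> and \<open>s *\<^sub>R b\<close> does not depend on the order of the
  sides, and the mean value inequality compares it with \<open>s\<^sup>2 *\<^sub>R f'' b a\<close>
  and with \<open>s\<^sup>2 *\<^sub>R f'' a b\<close>, up to an arbitrarily small multiple of
  s^2.\<close>

lemma second_derivative_symmetric:
  fixes f :: "'a::real_normed_vector \<Rightarrow> 'b::real_normed_vector"
  assumes "open W" "x \<in> W"
    and f': "\<And>y. y \<in> W \<Longrightarrow> (f has_derivative blinfun_apply (f' y)) (at y)"
    and f'': "(f' has_derivative blinfun_apply f'') (at x)"
  shows "f'' a b = f'' b a"
proof -
  define N where "N = (norm a + norm b + 1)"
  have N: "N > 0" "norm a \<le> N" "norm b \<le> N" "norm a + norm b \<le> N" by (auto simp: N_def add_pos_nonneg add_nonneg_pos)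
  have key: "norm (f'' a b - f'' b a) \<le> \<eta> * (4 * N * N)" if "\<eta> > 0" for \<eta>
  proof -
    obtain d0 where d0: "d0 > 0" "\<And>y. norm (y - x) < d0 \<Longrightarrow> norm (f' y - f' x - f'' (y - x)) \<le> \<eta> * norm (y - x)"
      using f'' \<open>\<eta> > 0\<close> unfolding has_derivative_at_alt by blast
    obtain d1 where d1: "d1 > 0" "ball x d1 \<subseteq> W" using assms(1,2) open_contains_ball by blast
    \<comment> \<open>This \<open>s\<close> keeps the whole parallelogram inside \<open>W\<close>
      and inside the ball where \<open>f'\<close> is affine up to the relative error
      \<open>\<eta>\<close>.\<close>
    define s where "s = min d0 d1 / (2 * N)"
    have s: "s > 0" "s * N < d0" "s * N < d1"
      using d0 d1 N(1) by (auto simp: s_def min_def field_simps)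
    have near: "y + r *\<^sub>R p \<in> W \<and> norm (f' (y + r *\<^sub>R p) - f' x - f'' (y + r *\<^sub>R p - x)) \<le> \<eta> * (s * N)"
      if "y \<in> closed_segment x (x + s *\<^sub>R q)" "norm p + norm q \<le> N" "r = 0 \<or> r = s" for y p q r
    proof -
      from that(1) obtain u where u: "0 \<le> u" "u \<le> 1" "y = (1 - u) *\<^sub>R x + u *\<^sub>R (x + s *\<^sub>R q)"
        unfolding in_segment by blast
      then have e: "y + r *\<^sub>R p - x = (u * s) *\<^sub>R q + r *\<^sub>R p" by (simp add: algebra_simps)
      have "norm (y + r *\<^sub>R p - x) \<le> norm ((u * s) *\<^sub>R q) + norm (r *\<^sub>R p)"
        unfolding e by (rule norm_triangle_ineq)
      also have "\<dots> = (u * s) * norm q + r * norm p"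
        using u(1) s(1) that(3) by auto
      also have "\<dots> \<le> s * norm q + s * norm p"
        using u s that(3) by (intro add_mono mult_right_mono) (auto simp: mult_le_cancel_right1)
      also have "\<dots> \<le> s * N" using that(2) s by (simp add: distrib_left [symmetric] add.commute)
      finally have *: "norm (y + r *\<^sub>R p - x) \<le> s * N" .
      then have "y + r *\<^sub>R p \<in> ball x d1" using s by (simp add: dist_norm norm_minus_commute)
      moreover have "norm (f' (y + r *\<^sub>R p) - f' x - f'' (y + r *\<^sub>R p - x)) \<le> \<eta> * (s * N)"
      proof (rule order_trans[OF d0(2)])
        show "norm (y + r *\<^sub>R p - x) < d0" using * s by linarith
        show "\<eta> * norm (y + r *\<^sub>R p - x) \<le> \<eta> * (s * N)"
          using * \<open>\<eta> > 0\<close> by (intro mult_left_mono) auto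
      qed
      ultimately show ?thesis using d1 by blast
    qed
    have half: "norm ((f (x + s *\<^sub>R q + s *\<^sub>R p) - f (x + s *\<^sub>R q)) - (f (x + s *\<^sub>R p) - f x) - s\<^sup>2 *\<^sub>R f'' p q)
      \<le> 2 * \<eta> * (s * N) * (s * N)" if pq: "norm p + norm q \<le> N" for p q
    proof -
      let ?S = "closed_segment x (x + s *\<^sub>R q)"
      \<comment> \<open>The side parallel to \<open>p\<close> is moved along \<open>q\<close>;
        subtracting the linear map \<open>f'' (s *\<^sub>R p)\<close> leaves a function whose
        derivative is of order \<open>\<eta> * s\<close>.\<close>
      let ?g = "\<lambda>y. f (y + s *\<^sub>R p) - f y - f'' (s *\<^sub>R p) y"
      have der: "(?g has_derivative blinfun_apply (f' (y + s *\<^sub>R p) - f' y - f'' (s *\<^sub>R p))) (at y within ?S)" if "y \<in> ?S" for y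
      proof -
        have 1: "(f has_derivative f' (y + s *\<^sub>R p)) (at (y + s *\<^sub>R p))"
          using near[OF that pq, of s] f' by auto
        have "((\<lambda>y. y + s *\<^sub>R p) has_derivative (\<lambda>h. h)) (at y within ?S)"
          by (auto intro!: derivative_eq_intros)
        from has_derivative_compose[OF this 1]
        have 2: "((\<lambda>y. f (y + s *\<^sub>R p)) has_derivative f' (y + s *\<^sub>R p)) (at y within ?S)" .
        have 3: "(f has_derivative f' y) (at y within ?S)"
          using near[OF that pq, of 0] f' by (auto intro: has_derivative_at_withinI)
        have 4: "(f'' (s *\<^sub>R p) has_derivative f'' (s *\<^sub>R p)) (at y within ?S)"
          by (intro bounded_linear_imp_has_derivative blinfun.bounded_linear_right)
        from has_derivative_diff[OF has_derivative_diff[OF 2 3] 4]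
        show ?thesis by (simp add: minus_blinfun.rep_eq [abs_def])
      qed
      have bd: "onorm (blinfun_apply (f' (y + s *\<^sub>R p) - f' y - f'' (s *\<^sub>R p))) \<le> 2 * \<eta> * (s * N)" if "y \<in> ?S" for y
      proof -
        have "f' (y + s *\<^sub>R p) - f' y - f'' (s *\<^sub>R p) =
          (f' (y + s *\<^sub>R p) - f' x - f'' (y + s *\<^sub>R p - x)) - (f' y - f' x - f'' (y - x))"
          by (simp add: blinfun.bilinear_simps)
        also have "norm \<dots> \<le> \<eta> * (s * N) + \<eta> * (s * N)"
          using near[OF that pq, of s] near[OF that pq, of 0]
          by (intro order_trans[OF norm_triangle_ineq4 add_mono]) auto
        finally have "norm (f' (y + s *\<^sub>R p) - f' y - f'' (s *\<^sub>R p)) \<le> \<eta> * (s * N) + \<eta> * (s * N)" .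
        then show ?thesis by (simp add: norm_blinfun.rep_eq mult_ac)
      qed
      have "norm (?g (x + s *\<^sub>R q) - ?g x) \<le> 2 * \<eta> * (s * N) * norm ((x + s *\<^sub>R q) - x)"
        by (rule differentiable_bound[OF convex_closed_segment der bd]) auto
      also have "\<dots> \<le> 2 * \<eta> * (s * N) * (s * N)"
      proof (intro mult_left_mono)
        have "norm q \<le> N" using pq norm_ge_zero[of p] by linarith
        then show "norm (x + s *\<^sub>R q - x) \<le> s * N" using s by simp
      qed (use s N \<open>\<eta> > 0\<close> in auto)
      finally show ?thesis by (simp add: blinfun.bilinear_simps algebra_simps power2_eq_square)
    qed
    have "norm (s\<^sup>2 *\<^sub>R (f'' a b - f'' b a)) \<le> 2 * \<eta> * (s * N) * (s * N) + 2 * \<eta> * (s * N) * (s * N)"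
    proof -
      have e: "s\<^sup>2 *\<^sub>R (f'' a b - f'' b a) =
        ((f (x + s *\<^sub>R a + s *\<^sub>R b) - f (x + s *\<^sub>R a)) - (f (x + s *\<^sub>R b) - f x) - s\<^sup>2 *\<^sub>R f'' b a) -
        ((f (x + s *\<^sub>R b + s *\<^sub>R a) - f (x + s *\<^sub>R b)) - (f (x + s *\<^sub>R a) - f x) - s\<^sup>2 *\<^sub>R f'' a b)"
        by (simp add: algebra_simps)
      show ?thesis unfolding e using half[of b a] half[of a b] N(4)
        by (intro order_trans[OF norm_triangle_ineq4 add_mono]) (auto simp: add.commute)
    qed
    then have "s\<^sup>2 * norm (f'' a b - f'' b a) \<le> s\<^sup>2 * (\<eta> * (4 * N * N))"
      unfolding norm_scaleR by (simp add: power2_eq_square mult_ac)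
    then show ?thesis using s by (simp add: mult_le_cancel_left_pos)
  qed
  have "norm (f'' a b - f'' b a) \<le> 0"
  proof (rule field_le_epsilon)
    fix e :: real assume "e > 0"
    have "norm (f'' a b - f'' b a) \<le> (e / (4 * N * N)) * (4 * N * N)"
      using \<open>e > 0\<close> N(1) by (intro key) auto
    then show "norm (f'' a b - f'' b a) \<le> 0 + e" using N(1) by simp
  qed
  then show ?thesis by simp
qed

section \<open>Isometric charts\<close>

text \<open>What an isometric chart provides, freed from curves and second derivatives. In
  tangential directions \<open>tangential_taylor\<close> improves on \<open>taylor\<close>: the
  error is of smaller order than the squared distance, because second derivatives are normal to the
  surface.\<close>

locale regular_chart =
  fixes U :: "'a::euclidean_space set" and \<phi> :: "'a \<Rightarrow> 'b::euclidean_space"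
    and D :: "'a \<Rightarrow> 'a \<Rightarrow>\<^sub>L 'b" and K L :: real
  assumes compact: "compact U" and convex: "convex U" and nonempty: "U \<noteq> {}"
    and K_pos: "K > 0" and L_pos: "L > 0"
    and nonexpansive: "\<And>u v. u \<in> U \<Longrightarrow> v \<in> U \<Longrightarrow> dist (\<phi> u) (\<phi> v) \<le> dist u v"
    and expansive: "\<And>u v. u \<in> U \<Longrightarrow> v \<in> U \<Longrightarrow> dist u v \<le> L * dist (\<phi> u) (\<phi> v)"
    and norm_D: "\<And>u w. u \<in> U \<Longrightarrow> norm (D u w) = norm w"
    and taylor: "\<And>u v. u \<in> U \<Longrightarrow> v \<in> U \<Longrightarrow>
      norm (\<phi> v - \<phi> u - D u (v - u)) \<le> K * (norm (v - u))\<^sup>2"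
    and tangential_taylor: "\<And>\<eta>. \<eta> > 0 \<Longrightarrow> \<exists>\<delta>>0. \<forall>u\<in>U. \<forall>v\<in>U. \<forall>\<tau>. norm (v - u) < \<delta> \<longrightarrow>
      \<bar>D u \<tau> \<bullet> (\<phi> v - \<phi> u) - \<tau> \<bullet> (v - u)\<bar> \<le> \<eta> * norm \<tau> * (norm (v - u))\<^sup>2"

lemma isometric_chart_nonexpansive:
  assumes "isometric_chart U \<phi> S" "u \<in> U" "v \<in> U"
  shows "dist (\<phi> u) (\<phi> v) \<le> dist u v"
proof -
  have "ennreal (dist (\<phi> u) (\<phi> v)) \<le> ennreal (dist u v)"
    using assms chord_le_intrinsic_dist[of "\<phi> u" "\<phi> v" S] by (simp add: isometric_chart_def)
  then show ?thesis by (simp add: ennreal_le_iff)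
qed

text \<open>The constant curve has length 0, so points with equal images have intrinsic distance
  0.\<close>

lemma isometric_chart_inj_on:
  assumes "isometric_chart U \<phi> S"
  shows "inj_on \<phi> U"
proof (rule inj_onI)
  fix u v assume uv: "u \<in> U" "v \<in> U" "\<phi> u = \<phi> v"
  have "path_image (\<lambda>_. \<phi> u) \<subseteq> S"
    using assms uv by (auto simp: path_image_def isometric_chart_def)
  then have "intrinsic_dist S (\<phi> u) (\<phi> u) \<le> ennreal 0"
    using intrinsic_dist_le[of "\<lambda>_. \<phi> u" 0 S]
    by (simp add: path_def pathstart_def pathfinish_def)
  moreover have "intrinsic_dist S (\<phi> u) (\<phi> v) = ennreal (dist u v)"
    using assms uv(1,2) by (simp add: isometric_chart_def)
  ultimately have "ennreal (dist u v) \<le> ennreal 0" using uv(3) by simp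
  then show "u = v" by (simp add: ennreal_le_iff)
qed

text \<open>The image of the segment from \<open>u\<close> to \<open>v\<close> competes in the
  infimum that defines the intrinsic distance, so a bound on its speed bounds
  \<open>dist u v\<close>.\<close>

lemma isometric_chart_le_onorm:
  assumes chart: "isometric_chart U \<phi> S" and "u \<in> U" "v \<in> U"
    and der: "\<And>x. x \<in> U \<Longrightarrow> (\<phi> has_derivative blinfun_apply (D x)) (at x)"
    and bound: "\<And>x. x \<in> closed_segment u v \<Longrightarrow> norm (D x (v - u)) \<le> B"
  shows "dist u v \<le> B"
proof -
  have U: "convex U" "\<phi> ` U = S" using chart by (auto simp: isometric_chart_def)
  let ?\<gamma> = "\<lambda>t. \<phi> (linepath u v t)"
  have lU: "linepath u v t \<in> closed_segment u v \<inter> U" if "t \<in> {0..1}" for t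
    using that convex_contains_segment[of U] U assms(2,3) path_image_linepath[of u v]
    by (force simp: path_image_def)
  have "0 \<le> norm (D u (v - u))" by simp
  also have "\<dots> \<le> B" by (rule bound) simp
  finally have B: "0 \<le> B" .
  have der\<gamma>: "(?\<gamma> has_derivative (\<lambda>h. D (linepath u v t) (h *\<^sub>R (v - u)))) (at t within {0..1})"
    if "t \<in> {0..1}" for t
  proof -
    have "(linepath u v has_derivative (\<lambda>h. h *\<^sub>R (v - u))) (at t within {0..1})"
      unfolding linepath_def
      by (auto intro!: derivative_eq_intros simp: algebra_simps)
    from has_derivative_compose[OF this der] lU[OF that] show ?thesis by auto
  qed
  have lip: "dist (?\<gamma> s) (?\<gamma> t) \<le> B * (t - s)" if "0 \<le> s" "s \<le> t" "t \<le> 1" for s t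
  proof -
    have "norm (?\<gamma> t - ?\<gamma> s) \<le> B * norm (t - s)"
    proof (rule differentiable_bound[of "{0..1}"])
      fix x :: real assume x: "x \<in> {0..1}"
      show "(?\<gamma> has_derivative (\<lambda>h. D (linepath u v x) (h *\<^sub>R (v - u)))) (at x within {0..1})"
        using der\<gamma>[OF x] .
      show "onorm (\<lambda>h. blinfun_apply (D (linepath u v x)) (h *\<^sub>R (v - u))) \<le> B"
        using bound[of "linepath u v x"] lU[OF x]
        by (intro onorm_le) (auto simp: blinfun.bilinear_simps mult.commute[of _ "\<bar>_\<bar>"] intro: mult_left_mono)
    qed (use that in auto)
    then show ?thesis using that by (simp add: dist_norm norm_minus_commute)
  qed
  have "path ?\<gamma>" unfolding path_def
    unfolding continuous_on_eq_continuous_within using has_derivative_continuous[OF der\<gamma>] by blast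
  moreover have "path_image ?\<gamma> \<subseteq> S" using lU U by (auto simp: path_image_def)
  ultimately have "intrinsic_dist S (\<phi> u) (\<phi> v) \<le> ennreal B"
    using intrinsic_dist_le[of ?\<gamma> B S] lip B
    by (simp add: pathstart_def pathfinish_def linepath_def)
  then show ?thesis
    using chart assms(2,3) B by (simp add: isometric_chart_def ennreal_le_iff)
qed

lemma point_in_segment:
  fixes u v :: "'a::real_vector"
  assumes "0 \<le> t" "t \<le> 1"
  shows "u + t *\<^sub>R (v - u) \<in> closed_segment u v"
  unfolding in_segment using assms by (intro exI[of _ t]) (auto simp: algebra_simps)

text \<open>First-order conditions along segments arise in this form: divide by \<open>s\<close> and
  let it tend to 0.\<close>

lemma nonpos_of_le_small_multiples:
  fixes m C :: real
  assumes "\<And>s. 0 < s \<Longrightarrow> s \<le> 1 \<Longrightarrow> s * m \<le> C * s\<^sup>2"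
  shows "m \<le> 0"
proof -
  have "((\<lambda>s. C * s) \<longlongrightarrow> C * 0) (at_right (0::real))" by (intro tendsto_intros)
  moreover have "eventually (\<lambda>s. m \<le> C * s) (at_right 0)"
    unfolding eventually_at_right_field
  proof (intro exI[of _ 1] conjI allI impI)
    fix s :: real assume s: "s > 0" "s < 1"
    have "s * m \<le> s * (C * s)" using assms[of s] s by (simp add: power2_eq_square mult.left_commute)
    then show "m \<le> C * s" using s by (simp add: mult_le_cancel_left_pos)
  qed simp
  ultimately have "m \<le> C * 0" by (intro tendsto_lowerbound[where F="at_right 0"]) auto
  then show ?thesis by simp
qed

text \<open>The differentials preserve norms: chords are not longer than parameter distances, which
  gives one inequality, and images of segments are not shorter than the segments, which gives the
  other. Differentiating the constant norm of \<open>f' x w\<close> shows that second derivatives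
  are normal. For arbitrary directions both facts are obtained at interior points and pass to the
  boundary by continuity.\<close>

lemma isometric_chart_regular:
  fixes \<phi> :: "real^'k \<Rightarrow> real^'d"
  assumes chart: "isometric_chart U \<phi> S"
  obtains D K L where "regular_chart U \<phi> D K L"
proof -
  have cU: "compact U" "convex U" and iU: "interior U \<noteq> {}"
    using chart by (auto simp: isometric_chart_def)
  have clU: "closure (interior U) = U"
    using cU iU convex_closure_interior compact_imp_closed closure_closed by metis
  obtain W f' f'' where W: "open W" "U \<subseteq> W"
    and f': "\<And>x. x \<in> W \<Longrightarrow> (\<phi> has_derivative blinfun_apply (f' x)) (at x)"
    and f'': "\<And>x. x \<in> W \<Longrightarrow> (f' has_derivative blinfun_apply (f'' x)) (at x)"
    and cont: "continuous_on W f''"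
    using chart unfolding isometric_chart_def C2_on_def by blast
  have contU: "continuous_on U f''" using cont W continuous_on_subset by blast
  have contf'U: "continuous_on U f'"
    by (intro continuous_at_imp_continuous_on ballI has_derivative_continuous[OF f'']) (use W in auto)
  have cont\<phi>U: "continuous_on U \<phi>"
    by (intro continuous_at_imp_continuous_on ballI has_derivative_continuous[OF f']) (use W in auto)
  have "bounded (f'' ` U)" using compact_continuous_image[OF contU cU(1)] compact_imp_bounded by blast
  then obtain K where K: "K > 0" "\<And>x. x \<in> U \<Longrightarrow> norm (f'' x) \<le> K"
    unfolding bounded_pos by blast
  have seg: "closed_segment u v \<subseteq> U" if "u \<in> U" "v \<in> U" for u v
    using cU(2) that convex_contains_segment by blast
  have Dlip: "norm (f' v - f' u) \<le> K * norm (v - u)" if "u \<in> U" "v \<in> U" for u v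
  proof (rule differentiable_bound[OF cU(2)])
    show "(f' has_derivative blinfun_apply (f'' x)) (at x within U)" if "x \<in> U" for x
      using f''[of x] W that by (auto intro: has_derivative_at_withinI)
    show "onorm (blinfun_apply (f'' x)) \<le> K" if "x \<in> U" for x
      using K(2)[OF that] by (simp add: norm_blinfun.rep_eq)
  qed (use that in auto)
  have taylor: "norm (\<phi> v - \<phi> u - f' u (v - u)) \<le> K * (norm (v - u))\<^sup>2" if uv: "u \<in> U" "v \<in> U" for u v
  proof -
    have "norm (\<phi> v - \<phi> u - f' u (v - u)) \<le> norm (v - u) * (K * norm (v - u))"
    proof (rule differentiable_bound_linearization[where S="closed_segment u v"])
      fix x assume x: "x \<in> closed_segment u v"
      then have xU: "x \<in> U" using seg uv by auto
      show "(\<phi> has_derivative blinfun_apply (f' x)) (at x within closed_segment u v)"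
        using f'[of x] W xU by (auto intro: has_derivative_at_withinI)
      have "norm (f' x - f' u) \<le> K * norm (x - u)" using Dlip xU uv by simp
      also have "\<dots> \<le> K * norm (v - u)"
        using x K segment_bound(1)[OF x] by (simp add: norm_minus_commute)
      finally show "onorm (blinfun_apply (f' x) - blinfun_apply (f' u)) \<le> K * norm (v - u)"
        by (simp add: norm_blinfun.rep_eq minus_blinfun.rep_eq fun_diff_def)
    qed (auto intro: point_in_segment)
    then show ?thesis by (simp add: power2_eq_square algebra_simps)
  qed
  \<comment> \<open>At a boundary point only directions that point into \<open>U\<close> can be
    tested, hence the form \<open>v - u\<close>.\<close>
  have feasible: "norm (f' u (v - u)) = norm (v - u)" if uv: "u \<in> U" "v \<in> U" for u v
  proof -
    have "\<bar>norm (f' u (v - u)) - norm (v - u)\<bar> \<le> 0"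
    proof (rule nonpos_of_le_small_multiples[where C="K * (norm (v - u))\<^sup>2"])
      fix s :: real assume s: "0 < s" "s \<le> 1"
      let ?p = "u + s *\<^sub>R (v - u)"
      have p: "?p \<in> U" using seg[OF uv] point_in_segment[of s u v] s by auto
      have bl: "f' u (?p - u) = s *\<^sub>R f' u (v - u)" by (simp add: blinfun.bilinear_simps)
      have "norm (f' u (?p - u)) \<le> norm (\<phi> ?p - \<phi> u) + norm (\<phi> ?p - \<phi> u - f' u (?p - u))"
        using norm_triangle_ineq4[of "\<phi> ?p - \<phi> u" "\<phi> ?p - \<phi> u - f' u (?p - u)"] by simp
      also have "\<dots> \<le> norm (?p - u) + K * (norm (?p - u))\<^sup>2"
        using taylor[OF uv(1) p] isometric_chart_nonexpansive[OF chart uv(1) p]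
        by (intro add_mono) (auto simp: dist_norm norm_minus_commute)
      finally have 1: "s * norm (f' u (v - u)) \<le> s * norm (v - u) + K * (norm (v - u))\<^sup>2 * s\<^sup>2"
        unfolding bl using s by (simp add: power_mult_distrib mult_ac)
      have "dist u ?p \<le> s * norm (f' u (v - u)) + K * (norm (v - u))\<^sup>2 * s\<^sup>2"
      proof (rule isometric_chart_le_onorm[OF chart uv(1) p, of f'])
        show "(\<phi> has_derivative blinfun_apply (f' x)) (at x)" if "x \<in> U" for x
          using f' W that by auto
        fix x assume x: "x \<in> closed_segment u ?p"
        then have xU: "x \<in> U" using seg uv p by blast
        have "f' x (?p - u) = f' u (?p - u) + (f' x - f' u) (?p - u)" by (simp only: blinfun.diff_left) simp
        then have "norm (f' x (?p - u)) \<le> norm (f' u (?p - u)) + norm ((f' x - f' u) (?p - u))"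
          by (simp only: norm_triangle_ineq)
        also have "norm ((f' x - f' u) (?p - u)) \<le> (K * norm (?p - u)) * norm (?p - u)"
        proof (intro order_trans[OF norm_blinfun] mult_right_mono)
          have "norm (f' x - f' u) \<le> K * norm (x - u)" using Dlip xU uv by simp
          also have "\<dots> \<le> K * norm (?p - u)"
            using segment_bound(1)[OF x] K(1) by (simp add: norm_minus_commute)
          finally show "norm (f' x - f' u) \<le> K * norm (?p - u)" .
        qed simp
        finally show "norm (f' x (?p - u)) \<le> s * norm (f' u (v - u)) + K * (norm (v - u))\<^sup>2 * s\<^sup>2"
          unfolding bl using s K(1) by (simp add: power2_eq_square mult_ac)
      qed
      then have 2: "s * norm (v - u) \<le> s * norm (f' u (v - u)) + K * (norm (v - u))\<^sup>2 * s\<^sup>2"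
        using s by (simp add: dist_norm)
      have "\<bar>s * norm (f' u (v - u)) - s * norm (v - u)\<bar> \<le> K * (norm (v - u))\<^sup>2 * s\<^sup>2"
        using 1 2 by linarith
      then show "s * \<bar>norm (f' u (v - u)) - norm (v - u)\<bar> \<le> K * (norm (v - u))\<^sup>2 * s\<^sup>2"
        using s by (simp add: right_diff_distrib [symmetric] abs_mult)
    qed
    then show ?thesis by simp
  qed
  have int_iso: "norm (f' u w) = norm w" if u: "u \<in> interior U" for u w
  proof -
    obtain e where e: "e > 0" "cball u e \<subseteq> U"
      using u mem_interior_cball by blast
    show ?thesis
    proof (cases "w = 0")
      case False
      let ?v = "u + (e / norm w) *\<^sub>R w"
      have "?v \<in> cball u e" using e False by (simp add: dist_norm)
      then have "?v \<in> U" "u \<in> U" using e by auto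
      then have "norm (f' u (?v - u)) = norm (?v - u)" using feasible by blast
      then show ?thesis using e False by (simp add: blinfun.bilinear_simps field_simps)
    qed (simp add: blinfun.bilinear_simps)
  qed
  have iso: "norm (f' u w) = norm w" if "u \<in> U" for u w
  proof (rule continuous_constant_on_closure[of "interior U" "\<lambda>u. norm (f' u w)"])
    show "continuous_on (closure (interior U)) (\<lambda>u. norm (blinfun_apply (f' u) w))"
      unfolding clU by (intro continuous_intros contf'U)
  qed (use int_iso that clU in auto)
  have inner_iso: "f' u a \<bullet> f' u b = a \<bullet> b" if "u \<in> U" for u a b
    using iso[OF that, of "a + b"] iso[OF that, of a] iso[OF that, of b]
    by (simp add: dot_norm blinfun.bilinear_simps)
  have int_normal: "f'' u \<tau> w \<bullet> f' u w = 0" if u: "u \<in> interior U" for u \<tau> w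
  proof -
    have uW: "u \<in> W" using u W interior_subset by blast
    have d1: "((\<lambda>x. f' x w) has_derivative (\<lambda>h. f'' u h w)) (at u)"
      using bounded_linear.has_derivative[OF blinfun.bounded_linear_left f''[OF uW]] .
    have "((\<lambda>x. f' x w \<bullet> f' x w) has_derivative (\<lambda>h. f' u w \<bullet> f'' u h w + f'' u h w \<bullet> f' u w)) (at u)"
      by (rule has_derivative_inner[OF d1 d1])
    moreover have "((\<lambda>x. f' x w \<bullet> f' x w) has_derivative (\<lambda>h. 0)) (at u)"
    proof (rule has_derivative_transform_within_open[of "\<lambda>x. w \<bullet> w"])
      show "w \<bullet> w = f' x w \<bullet> f' x w" if "x \<in> interior U" for x
        using inner_iso[of x w w] interior_subset that by (metis subsetD)
    qed (use u in auto)
    ultimately have "(\<lambda>h. f' u w \<bullet> f'' u h w + f'' u h w \<bullet> f' u w) = (\<lambda>h. 0)"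
      by (rule has_derivative_unique)
    then have "f' u w \<bullet> f'' u \<tau> w + f'' u \<tau> w \<bullet> f' u w = 0" by metis
    then show ?thesis by (simp add: inner_commute)
  qed
  have normal: "f'' u \<tau> w \<bullet> f' u w = 0" if "u \<in> U" for u \<tau> w
  proof (rule continuous_constant_on_closure[of "interior U" "\<lambda>u. f'' u \<tau> w \<bullet> f' u w"])
    show "continuous_on (closure (interior U)) (\<lambda>u. f'' u \<tau> w \<bullet> f' u w)"
      unfolding clU by (intro continuous_intros contf'U contU)
  qed (use int_normal that clU in auto)
  \<comment> \<open>Symmetry of \<open>f'' u\<close> makes the repeated vector \<open>w\<close> the
    direction of differentiation, which is the form that arises along the segment from
    \<open>u\<close> to \<open>v\<close>.\<close>
  have normal': "f'' u w \<tau> \<bullet> f' u w = 0" if "u \<in> U" for u \<tau> w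
    using normal[OF that] second_derivative_symmetric[of W u \<phi> f' "f'' u" w \<tau>] W f' f'' that by auto

  have tangential: "\<exists>\<delta>>0. \<forall>u\<in>U. \<forall>v\<in>U. \<forall>\<tau>. norm (v - u) < \<delta> \<longrightarrow>
      \<bar>f' u \<tau> \<bullet> (\<phi> v - \<phi> u) - \<tau> \<bullet> (v - u)\<bar> \<le> \<eta> * norm \<tau> * (norm (v - u))\<^sup>2" if "\<eta> > 0" for \<eta>
  proof -
    have "uniformly_continuous_on U f''" using compact_uniformly_continuous[OF contU cU(1)] .
    then obtain d where d: "d > 0" "\<And>x y. x \<in> U \<Longrightarrow> y \<in> U \<Longrightarrow> dist y x < d \<Longrightarrow> dist (f'' y) (f'' x) < \<eta> / 2"
      using \<open>\<eta> > 0\<close> unfolding uniformly_continuous_on_def by (meson half_gt_zero)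
    \<comment> \<open>The first entry controls the oscillation of \<open>f''\<close>, the second a
      product of two increments of \<open>f'\<close>, which is of third order.\<close>
    define \<delta> where "\<delta> = min d (\<eta> / (2 * K\<^sup>2))"
    have \<delta>: "\<delta> > 0" using d K \<open>\<eta> > 0\<close> by (simp add: \<delta>_def)
    have "\<bar>f' u \<tau> \<bullet> (\<phi> v - \<phi> u) - \<tau> \<bullet> (v - u)\<bar> \<le> \<eta> * norm \<tau> * (norm (v - u))\<^sup>2"
      if uv: "u \<in> U" "v \<in> U" and small: "norm (v - u) < \<delta>" for u v \<tau>
    proof -
      let ?w = "v - u"
      let ?g = "\<lambda>x. f' u \<tau> \<bullet> \<phi> x - \<tau> \<bullet> x"
      have dist_seg: "norm (x - u) \<le> norm ?w" if "x \<in> closed_segment u v" for x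
        using segment_bound(1)[OF that] by (simp add: norm_minus_commute)
      have lin: "norm (f' x - f' u - f'' u (x - u)) \<le> norm (x - u) * (\<eta> / 2)"
        if x: "x \<in> closed_segment u v" for x
      proof (rule differentiable_bound_linearization[where S="closed_segment u x"])
        fix y assume y: "y \<in> closed_segment u x"
        have xU: "x \<in> U" using seg uv x by blast
        then have yU: "y \<in> U" using seg uv y by blast
        show "(f' has_derivative blinfun_apply (f'' y)) (at y within closed_segment u x)"
          using f''[of y] W yU by (auto intro: has_derivative_at_withinI)
        have "norm (y - u) \<le> norm (x - u)"
          using segment_bound(1)[OF y] by (simp add: norm_minus_commute)
        then have "dist y u < d" using dist_seg[OF x] small by (simp add: dist_norm \<delta>_def)
        then have "norm (f'' y - f'' u) \<le> \<eta> / 2" using d(2)[OF uv(1) yU] by (simp add: dist_norm)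
        then show "onorm (blinfun_apply (f'' y) - blinfun_apply (f'' u)) \<le> \<eta> / 2"
          by (simp add: norm_blinfun.rep_eq minus_blinfun.rep_eq fun_diff_def)
      qed (auto intro: point_in_segment)
      have pointwise: "\<bar>f' u \<tau> \<bullet> f' x ?w - \<tau> \<bullet> ?w\<bar> \<le> \<eta> * norm \<tau> * (norm ?w)\<^sup>2"
        if x: "x \<in> closed_segment u v" for x
      proof -
        have xU: "x \<in> U" using seg uv x by blast
        obtain t where t: "0 \<le> t" "t \<le> 1" "x - u = t *\<^sub>R ?w"
          using x by (auto simp: in_segment algebra_simps)
        let ?E = "f' x - f' u - f'' u (x - u)"
        \<comment> \<open>As \<open>f' x\<close> preserves inner products,
          \<open>\<tau> \<bullet> ?w\<close> is replaced by
          \<open>f' x \<tau> \<bullet> f' x ?w\<close>. The leading term of what remains is a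
          multiple of \<open>f'' u ?w \<tau> \<bullet> f' u ?w\<close>, which vanishes.\<close>
        have "f' u \<tau> \<bullet> f' x ?w - \<tau> \<bullet> ?w = - ((f' x - f' u) \<tau> \<bullet> f' x ?w)"
          using inner_iso[OF xU, of \<tau> ?w] by (simp add: blinfun.bilinear_simps inner_diff_left)
        also have "(f' x - f' u) \<tau> \<bullet> f' x ?w = (f' x - f' u) \<tau> \<bullet> f' u ?w + (f' x - f' u) \<tau> \<bullet> (f' x - f' u) ?w"
          by (simp add: blinfun.bilinear_simps algebra_simps)
        also have "(f' x - f' u) \<tau> \<bullet> f' u ?w = ?E \<tau> \<bullet> f' u ?w"
          using normal'[OF uv(1), of ?w \<tau>] unfolding t(3)
          by (simp add: blinfun.bilinear_simps inner_diff_left)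
        finally have "\<bar>f' u \<tau> \<bullet> f' x ?w - \<tau> \<bullet> ?w\<bar> \<le>
          \<bar>?E \<tau> \<bullet> f' u ?w\<bar> + \<bar>(f' x - f' u) \<tau> \<bullet> (f' x - f' u) ?w\<bar>" by linarith
        also have "\<bar>?E \<tau> \<bullet> f' u ?w\<bar> \<le> \<eta> / 2 * norm \<tau> * (norm ?w)\<^sup>2"
        proof -
          have "\<bar>?E \<tau> \<bullet> f' u ?w\<bar> \<le> norm (?E \<tau>) * norm (f' u ?w)"
            by (rule Cauchy_Schwarz_ineq2)
          also have "\<dots> \<le> (norm ?E * norm \<tau>) * norm ?w"
            using norm_blinfun[of ?E \<tau>] iso[OF uv(1)] by (simp add: mult_right_mono)
          also have "\<dots> \<le> ((norm ?w * (\<eta> / 2)) * norm \<tau>) * norm ?w"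
            by (intro mult_right_mono order_trans[OF lin[OF x]] dist_seg[OF x])
              (use \<open>\<eta> > 0\<close> in auto)
          finally show ?thesis by (simp add: power2_eq_square mult_ac)
        qed
        also have "\<bar>(f' x - f' u) \<tau> \<bullet> (f' x - f' u) ?w\<bar> \<le> \<eta> / 2 * norm \<tau> * (norm ?w)\<^sup>2"
        proof -
          have le: "norm (f' x - f' u) \<le> K * norm ?w"
            by (intro order_trans[OF Dlip[OF uv(1) xU]] mult_left_mono dist_seg[OF x]) (use K in auto)
          have "\<bar>(f' x - f' u) \<tau> \<bullet> (f' x - f' u) ?w\<bar> \<le> norm ((f' x - f' u) \<tau>) * norm ((f' x - f' u) ?w)"
            by (rule Cauchy_Schwarz_ineq2)
          also have "\<dots> \<le> ((K * norm ?w) * norm \<tau>) * ((K * norm ?w) * norm ?w)"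
            by (intro mult_mono order_trans[OF norm_blinfun] mult_right_mono le) (use K in auto)
          also have "\<dots> = (K\<^sup>2 * norm ?w) * (norm \<tau> * (norm ?w)\<^sup>2)"
            by (simp add: power2_eq_square mult_ac)
          also have "\<dots> \<le> (\<eta> / 2) * (norm \<tau> * (norm ?w)\<^sup>2)"
            using small K(1) by (intro mult_right_mono) (auto simp: \<delta>_def field_simps)
          finally show ?thesis by (simp add: mult_ac)
        qed
        finally show ?thesis by (simp add: algebra_simps)
      qed
      define G where "G t = ?g (u + t *\<^sub>R ?w)" for t :: real
      have inseg: "u + t *\<^sub>R ?w \<in> closed_segment u v" if "t \<in> {0..1}" for t
        using that by (simp add: point_in_segment)
      have "norm (G 1 - G 0) \<le> \<eta> * norm \<tau> * (norm ?w)\<^sup>2 * norm (1 - 0 :: real)"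
      proof (rule differentiable_bound[of "{0..1}"])
        fix t :: real assume t: "t \<in> {0..1}"
        let ?x = "u + t *\<^sub>R ?w"
        have xW: "?x \<in> W" using inseg[OF t] seg uv W by blast
        have l: "((\<lambda>t. u + t *\<^sub>R ?w) has_derivative (\<lambda>h. h *\<^sub>R ?w)) (at t within {0..1})"
          by (auto intro!: derivative_eq_intros)
        have "((\<lambda>t. \<phi> (u + t *\<^sub>R ?w)) has_derivative (\<lambda>h. f' ?x (h *\<^sub>R ?w))) (at t within {0..1})"
          using has_derivative_compose[OF l f'[OF xW]] .
        from has_derivative_diff[OF has_derivative_inner_right[OF this] has_derivative_inner_right[OF l]]
        show "(G has_derivative (\<lambda>h. f' u \<tau> \<bullet> f' ?x (h *\<^sub>R ?w) - \<tau> \<bullet> (h *\<^sub>R ?w))) (at t within {0..1})"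
          unfolding G_def .
        show "onorm (\<lambda>h. f' u \<tau> \<bullet> f' ?x (h *\<^sub>R ?w) - \<tau> \<bullet> (h *\<^sub>R ?w)) \<le> \<eta> * norm \<tau> * (norm ?w)\<^sup>2"
        proof (rule onorm_le)
          fix h :: real
          have "norm (f' u \<tau> \<bullet> f' ?x (h *\<^sub>R ?w) - \<tau> \<bullet> (h *\<^sub>R ?w)) = \<bar>h\<bar> * \<bar>f' u \<tau> \<bullet> f' ?x ?w - \<tau> \<bullet> ?w\<bar>"
            unfolding real_norm_def abs_mult [symmetric]
            by (simp only: blinfun.scaleR_right inner_scaleR_right right_diff_distrib)
          also have "\<dots> \<le> \<bar>h\<bar> * (\<eta> * norm \<tau> * (norm ?w)\<^sup>2)"
            by (intro mult_left_mono pointwise inseg t) auto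
          finally show "norm (f' u \<tau> \<bullet> f' ?x (h *\<^sub>R ?w) - \<tau> \<bullet> (h *\<^sub>R ?w)) \<le> \<eta> * norm \<tau> * (norm ?w)\<^sup>2 * norm h"
            by (simp add: mult_ac)
        qed
      qed auto
      then show ?thesis by (simp add: G_def inner_diff_right algebra_simps)
    qed
    then show ?thesis using \<delta> by blast
  qed

  have "\<exists>L>0. \<forall>u\<in>U. \<forall>v\<in>U. dist u v \<le> L * dist (\<phi> u) (\<phi> v)"
  proof -
    \<comment> \<open>Taylor's estimate gives the factor 2 for parameters at distance at most
      \<open>1 / (2 * K)\<close>; the remaining pairs form a compact set on which, by injectivity,
      the chord has a positive minimum.\<close>
    let ?P = "{p \<in> U \<times> U. dist (fst p) (snd p) \<ge> 1 / (2 * K)}"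
    have local: "dist u v \<le> 2 * dist (\<phi> u) (\<phi> v)" if uv: "u \<in> U" "v \<in> U" "dist u v \<le> 1 / (2 * K)" for u v
    proof -
      have "norm (v - u) = norm (f' u (v - u))" using iso uv by simp
      also have "\<dots> \<le> norm (\<phi> v - \<phi> u) + norm (\<phi> v - \<phi> u - f' u (v - u))"
        using norm_triangle_ineq4[of "\<phi> v - \<phi> u" "\<phi> v - \<phi> u - f' u (v - u)"] by simp
      also have "norm (\<phi> v - \<phi> u - f' u (v - u)) \<le> (K * norm (v - u)) * norm (v - u)"
        using taylor[OF uv(1,2)] by (simp add: power2_eq_square mult_ac)
      also have "\<dots> \<le> (1/2) * norm (v - u)"
        using uv(3) K(1) by (intro mult_right_mono) (auto simp: dist_norm norm_minus_commute field_simps)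
      finally show ?thesis by (simp add: dist_norm norm_minus_commute)
    qed
    have "compact (U \<times> U)" using cU compact_Times by blast
    moreover have "closed {p::((real^'k) \<times> (real^'k)). dist (fst p) (snd p) \<ge> 1 / (2 * K)}"
      by (intro closed_Collect_le continuous_intros)
    ultimately have cP: "compact ?P"
      using compact_Int_closed by (auto simp: Collect_conj_eq)
    show ?thesis
    proof (cases "?P = {}")
      case True
      then have "dist u v \<le> 2 * dist (\<phi> u) (\<phi> v)" if "u \<in> U" "v \<in> U" for u v
        using local[OF that] that by force
      then show ?thesis by (intro exI[of _ 2]) auto
    next
      case False
      have "continuous_on ?P (\<lambda>p. dist (\<phi> (fst p)) (\<phi> (snd p)))"
        by (intro continuous_intros continuous_on_compose2[OF cont\<phi>U]) auto
      then obtain q where q: "q \<in> ?P" "\<And>p. p \<in> ?P \<Longrightarrow> dist (\<phi> (fst q)) (\<phi> (snd q)) \<le> dist (\<phi> (fst p)) (\<phi> (snd p))"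
        using continuous_attains_inf[OF cP False] by blast
      define m where "m = dist (\<phi> (fst q)) (\<phi> (snd q))"
      have "fst q \<noteq> snd q" using q(1) K(1) by auto
      moreover have "fst q \<in> U" "snd q \<in> U" using q(1) by (auto simp: mem_Times_iff)
      ultimately have "\<phi> (fst q) \<noteq> \<phi> (snd q)"
        using inj_onD[OF isometric_chart_inj_on[OF chart]] by blast
      then have m: "m > 0" by (simp add: m_def)
      have "dist u v \<le> max 2 (diameter U / m) * dist (\<phi> u) (\<phi> v)" if uv: "u \<in> U" "v \<in> U" for u v
      proof (cases "dist u v \<le> 1 / (2 * K)")
        case True
        from local[OF uv True] show ?thesis
          by (rule order_trans) (auto intro: mult_right_mono)
      next
        case False
        then have "m \<le> dist (\<phi> u) (\<phi> v)" using q(2)[of "(u, v)"] uv by (auto simp: m_def)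
        have "dist u v \<le> diameter U" using diameter_bounded_bound[OF compact_imp_bounded[OF cU(1)] uv] .
        also have "\<dots> = diameter U / m * m" using m by simp
        also have "\<dots> \<le> max 2 (diameter U / m) * dist (\<phi> u) (\<phi> v)"
          using m \<open>m \<le> _\<close> by (intro mult_mono) auto
        finally show ?thesis .
      qed
      then show ?thesis by (intro exI[of _ "max 2 (diameter U / m)"]) auto
    qed
  qed
  then obtain L where L: "L > 0" "\<And>u v. u \<in> U \<Longrightarrow> v \<in> U \<Longrightarrow> dist u v \<le> L * dist (\<phi> u) (\<phi> v)" by blast
  have "regular_chart U \<phi> f' K L"
  proof
    show "U \<noteq> {}" using iU by auto
  qed (fact cU K(1) L iso taylor tangential isometric_chart_nonexpansive[OF chart])+
  then show thesis by (rule that)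
qed

section \<open>Reach and touching balls\<close>

text \<open>The left side says that \<open>y\<close> is not inside the ball of radius
  \<open>t\<close> that touches at \<open>x\<close> and has its centre in direction
  \<open>n\<close>. Squaring turns this into an inequality in which \<open>t\<close> enters
  linearly.\<close>

lemma le_dist_ray_iff_inner_le:
  fixes x y n :: "'b::real_inner"
  assumes "t \<ge> 0" "norm n = 1"
  shows "t \<le> dist (x + t *\<^sub>R n) y \<longleftrightarrow> 2 * t * (n \<bullet> (y - x)) \<le> (norm (y - x))\<^sup>2"
proof -
  have "(dist (x + t *\<^sub>R n) y)\<^sup>2 = (norm (t *\<^sub>R n - (y - x)))\<^sup>2"
    by (simp add: dist_norm algebra_simps)
  also have "\<dots> = t\<^sup>2 - 2 * t * (n \<bullet> (y - x)) + (norm (y - x))\<^sup>2"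
    unfolding power2_norm_eq_inner inner_diff_left inner_diff_right
    using assms(2) by (simp add: inner_commute power2_eq_square algebra_simps flip: norm_eq_1)
  finally have "(dist (x + t *\<^sub>R n) y)\<^sup>2 = t\<^sup>2 - 2 * t * (n \<bullet> (y - x)) + (norm (y - x))\<^sup>2" .
  moreover have "t \<le> dist (x + t *\<^sub>R n) y \<longleftrightarrow> t\<^sup>2 \<le> (dist (x + t *\<^sub>R n) y)\<^sup>2"
    using assms(1) by (simp add: abs_le_square_iff [symmetric])
  ultimately show ?thesis by auto
qed

lemma closest_points_nonempty:
  fixes S :: "'b::euclidean_space set"
  assumes "compact S" "S \<noteq> {}"
  obtains y where "y \<in> closest_points S z"
proof -
  obtain y where "y \<in> S" "\<And>w. w \<in> S \<Longrightarrow> dist z y \<le> dist z w"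
    using distance_attains_inf[OF compact_imp_closed[OF assms(1)] assms(2), of z] by blast
  then show thesis by (intro that) (auto simp: closest_points_def)
qed

lemma closest_points_unique:
  assumes "ennreal R \<le> reach S" "y \<in> closest_points S z" "y' \<in> closest_points S z" "dist z y < R"
  shows "y = y'"
proof (rule ccontr)
  assume "y \<noteq> y'"
  then have "(y, z) \<in> {(x, z). x \<in> S \<and> (\<exists>y\<in>closest_points S z. \<exists>y'\<in>closest_points S z. y \<noteq> y')}"
    using assms(2,3) by (auto simp: closest_points_def)
  then have "reach S \<le> ennreal (dist y z)"
    unfolding reach_def by (rule INF_lower2) simp
  with assms(1) have "ennreal R \<le> ennreal (dist y z)" by (rule order_trans)
  then have "R \<le> dist y z" by (simp add: ennreal_le_iff)
  then show False using assms(4) by (simp add: dist_commute)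
qed

text \<open>With values in a compact set, continuity follows from a closed graph, and being a
  nearest point is a closed condition on pairs.\<close>

lemma continuous_on_nearest_point:
  fixes S :: "'b::euclidean_space set"
  assumes "compact S" "closed A"
    and near: "\<And>z. z \<in> A \<Longrightarrow> f z \<in> closest_points S z"
    and unique: "\<And>z y. z \<in> A \<Longrightarrow> y \<in> closest_points S z \<Longrightarrow> y = f z"
  shows "continuous_on A f"
proof -
  have fS: "f \<in> A \<rightarrow> S" using near by (auto simp: closest_points_def)
  have "(\<lambda>x. (x, f x)) ` A = (A \<times> S) \<inter> (\<Inter>w\<in>S. {p. dist (fst p) (snd p) \<le> dist (fst p) w})"
  proof (intro set_eqI iffI)
    fix p assume "p \<in> (\<lambda>x. (x, f x)) ` A"
    then show "p \<in> (A \<times> S) \<inter> (\<Inter>w\<in>S. {p. dist (fst p) (snd p) \<le> dist (fst p) w})"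
      using near by (auto simp: closest_points_def)
  next
    fix p assume "p \<in> (A \<times> S) \<inter> (\<Inter>w\<in>S. {p. dist (fst p) (snd p) \<le> dist (fst p) w})"
    then have "fst p \<in> A" "snd p \<in> closest_points S (fst p)"
      by (auto simp: closest_points_def)
    with unique have "p = (fst p, f (fst p))" by (simp add: prod_eq_iff)
    with \<open>fst p \<in> A\<close> show "p \<in> (\<lambda>x. (x, f x)) ` A" by (rule image_eqI[rotated])
  qed
  also have "closed \<dots>"
    by (intro closed_Int closed_Times closed_INT ballI closed_Collect_le continuous_intros
        assms(2) compact_imp_closed[OF assms(1)])
  finally show ?thesis
    unfolding continuous_closed_graph_eq[OF assms(1) fS]
    using fS by (intro closed_subset) auto
qed

text \<open>If the ball of radius \<open>\<tau>\<close> touching \<open>S\<close> at \<open>x\<close> were maximal with \<open>\<tau>\<close> below the reach,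
  Brouwer's theorem would give a point beyond its centre \<open>z0\<close> whose projection ray passes through
  \<open>z0\<close>; as \<open>z0\<close> projects only to \<open>x\<close>, this extends the ball.\<close>

lemma touching_ball_of_reach:
  fixes S :: "'b::euclidean_space set"
  assumes "compact S" "x \<in> S" "norm n = 1" "ennreal R \<le> reach S"
    and t0: "0 < t0" "\<And>y. y \<in> S \<Longrightarrow> t0 \<le> dist (x + t0 *\<^sub>R n) y"
    and t1: "t1 < R"
    and y: "y \<in> S"
  shows "t1 \<le> dist (x + t1 *\<^sub>R n) y"
proof (rule ccontr)
  assume contra: "\<not> t1 \<le> dist (x + t1 *\<^sub>R n) y"
  define P where "P t \<longleftrightarrow> (\<forall>y\<in>S. t \<le> dist (x + t *\<^sub>R n) y)" for t
  have P_mono: "P s" if "P t" "s \<le> t" for s t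
    unfolding P_def
  proof
    fix y assume "y \<in> S"
    then have "t \<le> dist (x + t *\<^sub>R n) y" using that by (simp add: P_def)
    also have "\<dots> \<le> dist (x + t *\<^sub>R n) (x + s *\<^sub>R n) + dist (x + s *\<^sub>R n) y" by (rule dist_triangle)
    also have "dist (x + t *\<^sub>R n) (x + s *\<^sub>R n) = t - s"
      using that \<open>norm n = 1\<close> by (simp add: dist_norm scaleR_diff_left [symmetric])
    finally show "s \<le> dist (x + s *\<^sub>R n) y" by simp
  qed
  have nP: "\<not> P t1" using contra y by (auto simp: P_def)
  have Pt0: "P t0" using t0 by (simp add: P_def)
  have t01: "t0 < t1" using P_mono[OF Pt0, of t1] nP by force
  define T where "T = {t \<in> {t0..t1}. P t}"
  have "T = {t0..t1} \<inter> (\<Inter>y\<in>S. {t. t \<le> dist (x + t *\<^sub>R n) y})"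
    by (auto simp: T_def P_def)
  moreover have "closed \<dots>"
    by (intro closed_Int closed_INT ballI closed_Collect_le continuous_intros closed_real_atLeastAtMost)
  ultimately have "closed T" by simp
  moreover have "bounded T" by (rule bounded_subset[of "{t0..t1}"]) (auto simp: T_def)
  ultimately have "compact T" by (simp add: compact_eq_bounded_closed)
  moreover have "t0 \<in> T" using Pt0 t01 by (simp add: T_def)
  then have "T \<noteq> {}" by blast
  ultimately obtain \<tau> where \<tau>: "\<tau> \<in> T" "\<And>t. t \<in> T \<Longrightarrow> t \<le> \<tau>"
    using compact_attains_sup[of T] by auto
  then have P\<tau>: "P \<tau>" and \<tau>0: "0 < \<tau>" and "\<tau> \<le> t1" using t0 by (auto simp: T_def)
  with nP have \<tau>1: "\<tau> < t1" by (cases "\<tau> = t1") auto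
  \<comment> \<open>All points of \<open>cball z0 \<eta>\<close> are within
    \<open>\<tau> + \<eta> = t1 < R\<close> of \<open>x\<close>, so their nearest points are unique;
    and the fixed point found below is exactly the centre \<open>x + t1 *\<^sub>R n\<close>.\<close>
  define \<eta> where "\<eta> = t1 - \<tau>"
  have \<eta>: "\<eta> > 0" using \<tau>1 by (simp add: \<eta>_def)
  define z0 where "z0 = x + \<tau> *\<^sub>R n"
  have dz0: "dist z0 x = \<tau>" using \<tau>0 \<open>norm n = 1\<close> by (simp add: z0_def dist_norm)
  have z0x: "x \<in> closest_points S z0"
    using P\<tau> \<open>x \<in> S\<close> dz0 by (simp add: closest_points_def P_def z0_def)
  have "\<exists>y. y \<in> closest_points S z" for z
    using closest_points_nonempty[OF \<open>compact S\<close>] \<open>x \<in> S\<close> by blast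
  then obtain \<pi> where \<pi>: "\<And>z. \<pi> z \<in> closest_points S z" by metis
  have \<pi>S: "\<pi> z \<in> S" for z using \<pi>[of z] by (simp add: closest_points_def)
  have \<pi>_le: "dist z (\<pi> z) \<le> dist z w" if "w \<in> S" for z w
    using \<pi>[of z] that by (simp add: closest_points_def)
  have \<pi>_unique: "y = \<pi> z" if "z \<in> cball z0 \<eta>" "y \<in> closest_points S z" for z y
  proof -
    have "dist z (\<pi> z) \<le> dist z x" using \<pi>_le \<open>x \<in> S\<close> by blast
    also have "\<dots> \<le> dist z z0 + dist z0 x" by (rule dist_triangle)
    also have "\<dots> < R" using that dz0 t1 by (simp add: \<eta>_def dist_commute)
    finally show ?thesis using closest_points_unique[OF assms(4) \<pi> that(2)] by simp
  qed
  have \<tau>_le: "\<tau> \<le> dist z0 (\<pi> z)" for z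
    using P\<tau> \<pi>S by (simp add: P_def z0_def)
  have ne: "norm (z0 - \<pi> z) \<noteq> 0" for z
    using \<tau>0 \<tau>_le[of z] unfolding dist_norm by linarith
  \<comment> \<open>\<open>F z\<close> lies at distance \<open>\<eta>\<close> from
    \<open>z0\<close>, on the side opposite to \<open>\<pi> z\<close>; a fixed point
    \<open>z1\<close> therefore has \<open>z0\<close> between itself and
    \<open>\<pi> z1\<close>.\<close>
  define F where "F z = z0 + (\<eta> / norm (z0 - \<pi> z)) *\<^sub>R (z0 - \<pi> z)" for z
  have "continuous_on (cball z0 \<eta>) \<pi>"
    by (rule continuous_on_nearest_point[OF \<open>compact S\<close> closed_cball \<pi> \<pi>_unique])
  then have "continuous_on (cball z0 \<eta>) F"
    unfolding F_def using ne by (intro continuous_intros) auto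
  moreover have dF: "dist z0 (F z) = \<eta>" for z
    using ne[of z] \<eta> by (simp add: F_def dist_norm)
  then have "F \<in> cball z0 \<eta> \<rightarrow> cball z0 \<eta>" by simp
  ultimately obtain z1 where z1: "z1 \<in> cball z0 \<eta>" "F z1 = z1"
    using brouwer_ball[OF \<eta>] by blast
  define s where "s = norm (z0 - \<pi> z1)"
  have s: "s > 0" using ne[of z1] by (simp add: s_def)
  have "z1 - \<pi> z1 = (z0 - \<pi> z1) + (\<eta> / s) *\<^sub>R (z0 - \<pi> z1)"
    using z1(2) by (simp add: F_def s_def algebra_simps)
  also have "\<dots> = ((s + \<eta>) / s) *\<^sub>R (z0 - \<pi> z1)"
    using s by (simp add: add_divide_distrib scaleR_add_left)
  finally have "dist z1 (\<pi> z1) = s + \<eta>"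
    using s \<eta> by (simp add: dist_norm) (simp add: s_def)
  \<comment> \<open>The ball of radius \<open>s\<close> about \<open>z0\<close> lies in the ball of
    radius \<open>s + \<eta>\<close> about \<open>z1\<close>, which has no point of \<open>S\<close>
    in its interior.\<close>
  then have "s \<le> dist z0 w" if "w \<in> S" for w
    using \<pi>_le[OF that, of z1] dist_triangle[of z1 w z0] dF[of z1] z1(2) by (simp add: dist_commute)
  then have "\<pi> z1 \<in> closest_points S z0"
    using \<pi>S by (simp add: closest_points_def s_def dist_norm)
  then have "\<pi> z1 = x" using \<pi>_unique[of z0] z0x \<eta> by (metis centre_in_cball less_imp_le)
  then have "z1 = x + t1 *\<^sub>R n"
    using z1(2) \<tau>0 \<open>norm n = 1\<close> by (simp add: F_def z0_def \<eta>_def scaleR_add_left [symmetric] add.assoc)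
  moreover have "dist z1 x = t1"
    using calculation t01 t0 \<open>norm n = 1\<close> by (simp add: dist_norm)
  ultimately have "P t1" using \<pi>_le[of _ z1] \<open>\<pi> z1 = x\<close> by (simp add: P_def)
  then show False using nP by simp
qed

section \<open>First-order conditions at nearest points and lower bounds for the reach\<close>

context regular_chart
begin

lemma norm_chord: "u \<in> U \<Longrightarrow> v \<in> U \<Longrightarrow> norm (\<phi> v - \<phi> u) \<le> norm (v - u)"
  using nonexpansive by (simp add: dist_norm norm_minus_commute)

lemma inner_D: "u \<in> U \<Longrightarrow> D u a \<bullet> D u b = a \<bullet> b"
  using norm_D[of u "a + b"] norm_D[of u a] norm_D[of u b]
  by (simp add: dot_norm blinfun.bilinear_simps)

lemma continuous_on_chart: "continuous_on U \<phi>"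
  unfolding continuous_on_iff using nonexpansive by (meson le_less_trans)

lemma compact_image: "compact (\<phi> ` U)"
  using compact_continuous_image[OF continuous_on_chart compact] .

lemma inj_on_chart: "inj_on \<phi> U"
  using expansive by (force intro!: inj_onI)

text \<open>First variation of the distance to \<open>z\<close> along the segment from
  \<open>u\<close> to \<open>v\<close>. At the boundary of \<open>U\<close> directions cannot be
  reversed, so instead of a normal vector one obtains an element of the polar cone of the feasible
  directions.\<close>

lemma closest_point_polar:
  assumes "u \<in> U" "v \<in> U" "\<phi> u \<in> closest_points (\<phi> ` U) z"
  shows "(z - \<phi> u) \<bullet> D u (v - u) \<le> 0"
proof (rule nonpos_of_le_small_multiples)
  fix s :: real assume s: "0 < s" "s \<le> 1"
  let ?p = "u + s *\<^sub>R (v - u)" and ?n = "z - \<phi> u"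
  have p: "?p \<in> U"
    using point_in_segment[of s u v] s assms(1,2) convex convex_contains_segment by auto
  let ?e = "\<phi> ?p - \<phi> u - D u (?p - u)"
  have "dist z (\<phi> u) \<le> dist z (\<phi> ?p)" using assms(3) p by (simp add: closest_points_def)
  then have "(norm ?n)\<^sup>2 \<le> (norm (?n - (\<phi> ?p - \<phi> u)))\<^sup>2" by (simp add: dist_norm)
  then have "2 * (?n \<bullet> (\<phi> ?p - \<phi> u)) \<le> (norm (\<phi> ?p - \<phi> u))\<^sup>2"
    unfolding power2_norm_eq_inner by (simp add: inner_diff_left inner_diff_right inner_commute)
  also have "\<dots> \<le> (norm (?p - u))\<^sup>2"
    by (intro power_mono norm_chord assms(1) p) auto
  finally have 1: "2 * (?n \<bullet> (\<phi> ?p - \<phi> u)) \<le> s\<^sup>2 * (norm (v - u))\<^sup>2"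
    by (simp add: power_mult_distrib)
  have "\<bar>?n \<bullet> ?e\<bar> \<le> norm ?n * norm ?e" by (rule Cauchy_Schwarz_ineq2)
  also have "\<dots> \<le> norm ?n * (K * (norm (?p - u))\<^sup>2)"
    by (intro mult_left_mono taylor assms(1) p) auto
  also have "\<dots> = norm ?n * K * (norm (v - u))\<^sup>2 * s\<^sup>2" by (simp add: power_mult_distrib)
  finally have 2: "\<bar>?n \<bullet> ?e\<bar> \<le> norm ?n * K * (norm (v - u))\<^sup>2 * s\<^sup>2" .
  have "s * (?n \<bullet> D u (v - u)) = ?n \<bullet> (\<phi> ?p - \<phi> u) - ?n \<bullet> ?e"
    by (simp add: inner_diff_right blinfun.scaleR_right)
  then show "s * (?n \<bullet> D u (v - u)) \<le> ((norm (v - u))\<^sup>2 / 2 + norm ?n * K * (norm (v - u))\<^sup>2) * s\<^sup>2"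
    using 1 2 by (simp add: algebra_simps)
qed

text \<open>The first-order term has the favourable sign, so only the Taylor remainder counts;
  \<open>L\<close> turns the parameter distance in it into a chord. For a unit vector
  \<open>n\<close> this is a touching ball of radius \<open>1 / (2 * K * L\<^sup>2)\<close>, still
  dependent on the chart.\<close>

lemma polar_inner_le:
  assumes "u \<in> U" "v \<in> U" and polar: "n \<bullet> D u (v - u) \<le> 0"
  shows "n \<bullet> (\<phi> v - \<phi> u) \<le> K * L\<^sup>2 * norm n * (norm (\<phi> v - \<phi> u))\<^sup>2"
proof -
  have "n \<bullet> (\<phi> v - \<phi> u) \<le> n \<bullet> (\<phi> v - \<phi> u - D u (v - u))"
    using polar by (simp add: inner_diff_right)
  also have "\<dots> \<le> norm n * norm (\<phi> v - \<phi> u - D u (v - u))" by (rule norm_cauchy_schwarz)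
  also have "\<dots> \<le> norm n * (K * (norm (v - u))\<^sup>2)"
    by (intro mult_left_mono taylor assms(1,2)) auto
  also have "\<dots> \<le> norm n * (K * (L * norm (\<phi> v - \<phi> u))\<^sup>2)"
    using K_pos expansive[OF assms(1,2)]
    by (intro mult_left_mono power_mono) (auto simp: dist_norm norm_minus_commute)
  finally show ?thesis by (simp add: power_mult_distrib mult_ac)
qed

text \<open>Two nearest points \<open>y\<close> and \<open>y'\<close> of \<open>z\<close> make the
  inner product of \<open>z - y\<close> with \<open>y' - y\<close> at least half the square of
  \<open>norm (y' - y)\<close>; \<open>polar_inner_le\<close> then forces \<open>z\<close> away from
  the surface.\<close>

lemma reach_ge: "ennreal (1 / (2 * K * L\<^sup>2)) \<le> reach (\<phi> ` U)"
  unfolding reach_def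
proof (rule INF_greatest, clarify)
  fix u0 z y y'
  assume u0: "u0 \<in> U" and cl: "y \<in> closest_points (\<phi> ` U) z" "y' \<in> closest_points (\<phi> ` U) z" and "y \<noteq> y'"
  obtain u v where uv: "u \<in> U" "y = \<phi> u" "v \<in> U" "y' = \<phi> v"
    using cl by (auto simp: closest_points_def)
  let ?n = "z - \<phi> u" and ?d = "norm (\<phi> v - \<phi> u)"
  have d: "?d > 0" using \<open>y \<noteq> y'\<close> uv by auto
  have "dist z (\<phi> v) \<le> dist z (\<phi> u)" "dist z (\<phi> u) \<le> dist z (\<phi> u0)"
    using cl uv u0 by (auto simp: closest_points_def)
  then have "(norm (?n - (\<phi> v - \<phi> u)))\<^sup>2 \<le> (norm ?n)\<^sup>2" by (simp add: dist_norm)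
  then have "?d\<^sup>2 \<le> 2 * (?n \<bullet> (\<phi> v - \<phi> u))"
    unfolding power2_norm_eq_inner by (simp add: inner_diff_left inner_diff_right inner_commute)
  also have "\<dots> \<le> 2 * (K * L\<^sup>2 * norm ?n * ?d\<^sup>2)"
    using polar_inner_le[OF uv(1,3)] closest_point_polar[OF uv(1,3)] cl(1) uv by simp
  finally have "1 \<le> 2 * K * L\<^sup>2 * norm ?n" using d by simp
  then have "1 / (2 * K * L\<^sup>2) \<le> norm ?n" using K_pos L_pos by (simp add: field_simps)
  also have "\<dots> \<le> dist (\<phi> u0) z"
    using \<open>dist z (\<phi> u) \<le> dist z (\<phi> u0)\<close> by (simp add: dist_norm norm_minus_commute)
  finally show "ennreal (1 / (2 * K * L\<^sup>2)) \<le> ennreal (dist (\<phi> u0) z)"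
    by (rule ennreal_leI)
qed

text \<open>The chart only has to supply some touching ball, of radius \<open>t0\<close>;
  \<open>touching_ball_of_reach\<close> enlarges it to every radius below the reach, and
  \<open>K\<close> and \<open>L\<close> disappear from the estimate.\<close>

lemma polar_touching_ball:
  assumes "ennreal R \<le> reach (\<phi> ` U)" "0 \<le> r" "r < R"
    and u: "u \<in> U" and polar: "\<And>v. v \<in> U \<Longrightarrow> n \<bullet> D u (v - u) \<le> 0"
    and y: "y \<in> \<phi> ` U"
  shows "2 * r * (n \<bullet> (y - \<phi> u)) \<le> norm n * (norm (y - \<phi> u))\<^sup>2"
proof (cases "n = 0")
  case False
  define m where "m = n /\<^sub>R norm n"
  have m: "norm m = 1" using False by (simp add: m_def)
  define t0 where "t0 = 1 / (2 * K * L\<^sup>2)"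
  have t0: "t0 > 0" using K_pos L_pos by (simp add: t0_def)
  have "r \<le> dist (\<phi> u + r *\<^sub>R m) y"
  proof (rule touching_ball_of_reach[OF compact_image _ m assms(1) t0 _ \<open>r < R\<close> y])
    fix w assume "w \<in> \<phi> ` U"
    then obtain v where v: "v \<in> U" "w = \<phi> v" by blast
    have "m \<bullet> D u (v - u) \<le> 0"
      using polar[OF v(1)] False by (simp add: m_def mult_nonneg_nonpos)
    from polar_inner_le[OF u v(1) this]
    have "m \<bullet> (w - \<phi> u) \<le> K * L\<^sup>2 * (norm (w - \<phi> u))\<^sup>2" using m v by simp
    then have "2 * t0 * (m \<bullet> (w - \<phi> u)) \<le> 2 * t0 * (K * L\<^sup>2 * (norm (w - \<phi> u))\<^sup>2)"
      using t0 by (intro mult_left_mono) auto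
    also have "\<dots> = (norm (w - \<phi> u))\<^sup>2"
      using K_pos L_pos by (simp add: t0_def)
    finally show "t0 \<le> dist (\<phi> u + t0 *\<^sub>R m) w"
      using le_dist_ray_iff_inner_le[of t0 m] t0 m by simp
  qed (use u in auto)
  then have "2 * r * (m \<bullet> (y - \<phi> u)) \<le> (norm (y - \<phi> u))\<^sup>2"
    using le_dist_ray_iff_inner_le[of r m] assms(2) m by simp
  then have "norm n * (2 * r * (m \<bullet> (y - \<phi> u))) \<le> norm n * (norm (y - \<phi> u))\<^sup>2"
    by (intro mult_left_mono) auto
  moreover have "norm n * (m \<bullet> (y - \<phi> u)) = n \<bullet> (y - \<phi> u)"
    using False by (simp add: m_def)
  then have "norm n * (2 * r * (m \<bullet> (y - \<phi> u))) = 2 * r * (n \<bullet> (y - \<phi> u))"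
    by (simp add: mult.left_commute)
  ultimately show ?thesis by simp
qed simp

end

section \<open>Comparison of intrinsic distances\<close>

lemma norm_le_of_inner_le:
  fixes e :: "'b::real_inner"
  assumes "e \<bullet> e \<le> norm e * B" "0 \<le> B"
  shows "norm e \<le> B"
proof (cases "e = 0")
  case False
  have "norm e * norm e \<le> norm e * B"
    using assms(1) by (simp add: power2_norm_eq_inner [symmetric] power2_eq_square)
  then show ?thesis using False by simp
qed (use assms in simp)

text \<open>Expand the inner product of \<open>z' - z = (z' - a') + (a' - a) - (z - a)\<close> with
  \<open>a' - a\<close>. For \<open>\<theta> = 0\<close> this is the argument that projection to a
  convex set is nonexpansive.\<close>

lemma dist_le_of_obtuse:
  fixes a a' z z' :: "'b::real_inner"
  assumes "(z - a) \<bullet> (a' - a) \<le> \<theta> * (norm (a' - a))\<^sup>2"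
    and "(z' - a') \<bullet> (a - a') \<le> \<theta> * (norm (a' - a))\<^sup>2"
  shows "(1 - 2 * \<theta>) * norm (a' - a) \<le> norm (z' - z)"
proof (cases "a' = a")
  case False
  have "(1 - 2 * \<theta>) * (norm (a' - a))\<^sup>2 \<le>
      (norm (a' - a))\<^sup>2 - (z - a) \<bullet> (a' - a) - (z' - a') \<bullet> (a - a')"
    using assms by (simp add: algebra_simps)
  also have "\<dots> = (z' - z) \<bullet> (a' - a)"
    unfolding power2_norm_eq_inner by (simp add: algebra_simps inner_commute)
  also have "\<dots> \<le> norm (z' - z) * norm (a' - a)" by (rule norm_cauchy_schwarz)
  finally show ?thesis using False by (simp add: power2_eq_square)
qed simp

text \<open>The touching condition is what is retained of the reach. It admits all \<open>n\<close>
  in the polar cone of the feasible directions, not only normal vectors, since nearest points may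
  lie on the boundary. The radius \<open>r\<close> will be shared by both surfaces, whereas each
  keeps its own \<open>K\<close> and \<open>L\<close>.\<close>

locale rolling_chart = regular_chart +
  fixes r :: real
  assumes r_pos: "r > 0"
    and touching: "\<And>u n y. u \<in> U \<Longrightarrow> (\<And>v. v \<in> U \<Longrightarrow> n \<bullet> D u (v - u) \<le> 0) \<Longrightarrow> y \<in> \<phi> ` U \<Longrightarrow>
      2 * r * (n \<bullet> (y - \<phi> u)) \<le> norm n * (norm (y - \<phi> u))\<^sup>2"
begin

text \<open>The adjoint of \<open>D u\<close>. As \<open>D u\<close> preserves norms for
  \<open>u \<in> U\<close>, the vector \<open>D u (T u n)\<close> is the orthogonal projection of
  \<open>n\<close> to the tangent directions.\<close>

definition T :: "'a \<Rightarrow> 'b \<Rightarrow> 'a" where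
  "T u n = (\<Sum>b\<in>Basis. (n \<bullet> D u b) *\<^sub>R b)"

lemma T_inner: "T u n \<bullet> w = n \<bullet> D u w"
proof -
  have "n \<bullet> D u w = n \<bullet> D u (\<Sum>b\<in>Basis. (w \<bullet> b) *\<^sub>R b)" by (simp add: euclidean_representation)
  also have "\<dots> = (\<Sum>b\<in>Basis. (w \<bullet> b) * (n \<bullet> D u b))"
    by (simp add: blinfun.sum_right blinfun.scaleR_right inner_sum_right)
  finally show ?thesis by (simp add: T_def inner_sum_left) (simp add: mult.commute inner_commute)
qed

lemma T_add: "T u (m + n) = T u m + T u n"
  and T_diff: "T u (m - n) = T u m - T u n"
  and T_scaleR: "T u (c *\<^sub>R n) = c *\<^sub>R T u n"
  by (rule vector_eq_rdot[THEN iffD1], simp add: T_inner inner_add_left inner_diff_left)+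

lemma norm_T_le: assumes "u \<in> U" shows "norm (T u n) \<le> norm n"
proof (rule norm_le_of_inner_le)
  have "T u n \<bullet> T u n = n \<bullet> D u (T u n)" by (rule T_inner)
  also have "\<dots> \<le> norm n * norm (D u (T u n))" by (rule norm_cauchy_schwarz)
  finally show "T u n \<bullet> T u n \<le> norm (T u n) * norm n"
    using norm_D[OF assms] by (simp add: mult.commute)
qed simp

abbreviation (input) normal :: "'a \<Rightarrow> 'b \<Rightarrow> bool" where
  "normal u n \<equiv> \<forall>w. n \<bullet> D u w = 0"

lemma normal_part: "u \<in> U \<Longrightarrow> normal u (n - D u (T u n))"
  by (simp add: inner_diff_left inner_D T_inner)

lemma normal_inner_le:
  assumes "u \<in> U" "normal u n" "y \<in> \<phi> ` U" "norm (y - \<phi> u) \<le> A"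
  shows "\<bar>n \<bullet> (y - \<phi> u)\<bar> \<le> norm n * (A\<^sup>2 / (2 * r))"
proof -
  have "2 * r * (n \<bullet> (y - \<phi> u)) \<le> norm n * (norm (y - \<phi> u))\<^sup>2"
    "2 * r * ((- n) \<bullet> (y - \<phi> u)) \<le> norm (- n) * (norm (y - \<phi> u))\<^sup>2"
    by (rule touching; use assms in simp)+
  then have "2 * r * \<bar>n \<bullet> (y - \<phi> u)\<bar> \<le> norm n * (norm (y - \<phi> u))\<^sup>2" by (auto simp: abs_if)
  also have "\<dots> \<le> norm n * A\<^sup>2" using assms by (intro mult_left_mono power_mono) auto
  finally show ?thesis using r_pos by (simp add: field_simps)
qed

lemma normal_combination_le:
  fixes y :: "'a \<Rightarrow> 'b" and c :: 'a
  assumes u: "u \<in> U" "normal u n"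
    and y0: "y0 \<in> \<phi> ` U" "norm (y0 - \<phi> u) \<le> A"
    and y: "\<And>b. b \<in> Basis \<Longrightarrow> y b \<in> \<phi> ` U" "\<And>b. b \<in> Basis \<Longrightarrow> norm (y b - \<phi> u) \<le> A"
  shows "\<bar>n \<bullet> (\<Sum>b\<in>Basis. (c \<bullet> b) *\<^sub>R (y b - y0))\<bar> \<le> norm n * (norm c * DIM('a) * (A\<^sup>2 / r))"
proof -
  have "\<bar>n \<bullet> (y b - y0)\<bar> \<le> norm n * (A\<^sup>2 / r)" if "b \<in> Basis" for b
  proof -
    have "n \<bullet> (y b - y0) = n \<bullet> (y b - \<phi> u) - n \<bullet> (y0 - \<phi> u)" by (simp add: inner_diff_right)
    moreover have "\<bar>n \<bullet> (y b - \<phi> u)\<bar> \<le> norm n * (A\<^sup>2 / (2 * r))"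
      "\<bar>n \<bullet> (y0 - \<phi> u)\<bar> \<le> norm n * (A\<^sup>2 / (2 * r))"
      by (rule normal_inner_le; use that u y0 y in simp)+
    ultimately have "\<bar>n \<bullet> (y b - y0)\<bar> \<le> norm n * (A\<^sup>2 / (2 * r)) + norm n * (A\<^sup>2 / (2 * r))" by linarith
    then show ?thesis by (simp add: field_simps)
  qed
  then have *: "\<bar>(c \<bullet> b) * (n \<bullet> (y b - y0))\<bar> \<le> norm c * (norm n * (A\<^sup>2 / r))" if "b \<in> Basis" for b
    unfolding abs_mult using Basis_le_norm[OF that, of c] that by (intro mult_mono) auto
  have "\<bar>n \<bullet> (\<Sum>b\<in>Basis. (c \<bullet> b) *\<^sub>R (y b - y0))\<bar> = \<bar>\<Sum>b\<in>Basis. (c \<bullet> b) * (n \<bullet> (y b - y0))\<bar>"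
    by (simp add: inner_sum_right)
  also have "\<dots> \<le> (\<Sum>b\<in>Basis. \<bar>(c \<bullet> b) * (n \<bullet> (y b - y0))\<bar>)" by (rule sum_abs)
  also have "\<dots> \<le> (\<Sum>b\<in>(Basis::'a set). norm c * (norm n * (A\<^sup>2 / r)))" by (intro sum_mono *)
  finally show ?thesis by (simp add: mult_ac)
qed

text \<open>The differences \<open>y b - y0\<close> are nearly tangent to the surface; being well conditioned
  and as many as its dimension, they nearly span the tangent space.\<close>

lemma approx_by_combination:
  fixes y :: "'a \<Rightarrow> 'b"
  assumes u: "u \<in> U"
    and y0: "y0 \<in> \<phi> ` U" "norm (y0 - \<phi> u) \<le> A"
    and y: "\<And>b. b \<in> Basis \<Longrightarrow> y b \<in> \<phi> ` U" "\<And>b. b \<in> Basis \<Longrightarrow> norm (y b - \<phi> u) \<le> A"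
    and x: "x \<in> \<phi> ` U" "norm (x - \<phi> u) \<le> A"
    and wc: "\<And>c::'a. \<mu> * norm c \<le> norm (\<Sum>b\<in>Basis. (c \<bullet> b) *\<^sub>R (y b - y0))"
    and small: "DIM('a) * (A\<^sup>2 / r) \<le> \<mu> / 2" and "\<mu> > 0"
  obtains c :: 'a where "norm c \<le> 2 * A / \<mu>"
    "norm (\<phi> u - x - (\<Sum>b\<in>Basis. (c \<bullet> b) *\<^sub>R (y b - y0))) \<le> A\<^sup>2 / (2 * r) + norm c * DIM('a) * (A\<^sup>2 / r)"
proof -
  define V where "V c = (\<Sum>b\<in>Basis. (c \<bullet> b) *\<^sub>R (y b - y0))" for c :: 'a
  have A: "A \<ge> 0" using y0(2) norm_ge_zero order_trans by blast
  have V_le: "\<bar>n \<bullet> V c\<bar> \<le> norm n * (norm c * DIM('a) * (A\<^sup>2 / r))" if "normal u n" for n c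
    unfolding V_def by (rule normal_combination_le) (use that u y0 y in auto)
  have linV: "linear V"
    unfolding V_def by (rule linearI)
      (auto simp: inner_add_left scaleR_add_left sum.distrib scaleR_sum_right)
  define G where "G c = T u (V c)" for c
  have linG: "linear G"
    unfolding G_def by (rule linearI) (auto simp: linear_add[OF linV] linear_scale[OF linV] T_add T_scaleR)
  \<comment> \<open>By \<open>small\<close>, the normal part of \<open>V c\<close> uses up at most
    half of the lower bound \<open>\<mu> * norm c\<close>; the other half is left for the tangential
    part.\<close>
  have G_ge: "\<mu> / 2 * norm c \<le> norm (G c)" for c
  proof -
    let ?e = "V c - D u (G c)"
    have ne: "normal u ?e" unfolding G_def by (rule normal_part[OF u])
    have "?e \<bullet> ?e = ?e \<bullet> V c" using ne by (simp add: inner_diff_right)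
    also have "\<dots> \<le> norm ?e * (norm c * DIM('a) * (A\<^sup>2 / r))" using V_le[OF ne, of c] by simp
    finally have "norm ?e \<le> norm c * DIM('a) * (A\<^sup>2 / r)"
      using r_pos by (intro norm_le_of_inner_le) auto
    also have "\<dots> \<le> norm c * (\<mu> / 2)"
      using mult_left_mono[OF small norm_ge_zero[of c]] by (simp add: mult.assoc)
    finally have "norm ?e \<le> norm c * (\<mu> / 2)" .
    moreover have "norm (V c) \<le> norm ?e + norm (D u (G c))"
      using norm_triangle_ineq[of ?e "D u (G c)"] by simp
    ultimately show ?thesis using wc[of c] norm_D[OF u] by (simp add: V_def algebra_simps)
  qed
  have "inj G"
  proof (rule injI)
    fix c c' assume "G c = G c'"
    then have "G (c - c') = 0" by (simp add: linear_diff[OF linG])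
    then show "c = c'" using G_ge[of "c - c'"] \<open>\<mu> > 0\<close> by (simp add: mult_le_0_iff)
  qed
  then have "surj G" using linear_injective_imp_surjective[OF linG] by blast
  \<comment> \<open>With this \<open>c\<close> the tangential parts of \<open>V c\<close> and
    \<open>\<phi> u - x\<close> agree, so their difference is normal at \<open>u\<close> and its
    inner products with chords of the surface are of second order.\<close>
  then obtain c where c: "G c = T u (\<phi> u - x)" by (metis surjD)
  let ?e = "\<phi> u - x - V c"
  have "\<mu> / 2 * norm c \<le> norm (\<phi> u - x)" using G_ge[of c] norm_T_le[OF u] c by (metis order_trans)
  also have "\<dots> \<le> A" using x(2) by (simp add: norm_minus_commute)
  finally have 1: "norm c \<le> 2 * A / \<mu>" using \<open>\<mu> > 0\<close> by (simp add: field_simps)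
  have "T u ?e = 0" using c by (simp add: T_diff G_def)
  then have ne: "normal u ?e" using T_inner[of u ?e] by simp
  have "?e \<bullet> ?e = - (?e \<bullet> (x - \<phi> u)) - ?e \<bullet> V c" by (simp add: inner_diff_right)
  also have "\<dots> \<le> norm ?e * (A\<^sup>2 / (2 * r)) + norm ?e * (norm c * DIM('a) * (A\<^sup>2 / r))"
    using normal_inner_le[OF u ne x] V_le[OF ne, of c] by linarith
  finally have "norm ?e \<le> A\<^sup>2 / (2 * r) + norm c * DIM('a) * (A\<^sup>2 / r)"
    using r_pos by (intro norm_le_of_inner_le) (auto simp: distrib_left)
  with 1 show thesis by (intro that[of c]) (auto simp: V_def)
qed

text \<open>In the application \<open>z\<close> lies on the other surface. Decompose
  \<open>z - \<phi> u\<close> into \<open>z - x - V\<close>, \<open>x - \<phi> u\<close> and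
  \<open>V\<close>, with \<open>V\<close> the frame combination: the first is small by assumption,
  the others have small normal parts because \<open>x\<close> and the frame lie on this
  surface.\<close>

lemma normal_part_le:
  fixes y :: "'a \<Rightarrow> 'b" and c :: 'a
  assumes u: "u \<in> U"
    and y0: "y0 \<in> \<phi> ` U" "norm (y0 - \<phi> u) \<le> A"
    and y: "\<And>b. b \<in> Basis \<Longrightarrow> y b \<in> \<phi> ` U" "\<And>b. b \<in> Basis \<Longrightarrow> norm (y b - \<phi> u) \<le> A"
    and x: "x \<in> \<phi> ` U" "norm (x - \<phi> u) \<le> A"
    and z: "norm (z - x - (\<Sum>b\<in>Basis. (c \<bullet> b) *\<^sub>R (y b - y0))) \<le> E"
  shows "norm ((z - \<phi> u) - D u (T u (z - \<phi> u))) \<le> E + A\<^sup>2 / (2 * r) + norm c * DIM('a) * (A\<^sup>2 / r)"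
proof (rule norm_le_of_inner_le)
  let ?V = "\<Sum>b\<in>Basis. (c \<bullet> b) *\<^sub>R (y b - y0)"
  let ?e = "(z - \<phi> u) - D u (T u (z - \<phi> u))"
  have ne: "normal u ?e" by (rule normal_part[OF u])
  have "?e \<bullet> ?e = ?e \<bullet> (z - \<phi> u)" using ne by (simp add: inner_diff_right)
  also have "\<dots> = ?e \<bullet> (z - x - ?V) + ?e \<bullet> (x - \<phi> u) + ?e \<bullet> ?V"
    unfolding inner_add_right [symmetric] by simp
  also have "\<dots> \<le> norm ?e * E + norm ?e * (A\<^sup>2 / (2 * r)) + norm ?e * (norm c * DIM('a) * (A\<^sup>2 / r))"
  proof (intro add_mono)
    have "?e \<bullet> (z - x - ?V) \<le> norm ?e * norm (z - x - ?V)" by (rule norm_cauchy_schwarz)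
    also have "\<dots> \<le> norm ?e * E" using z by (intro mult_left_mono) auto
    finally show "?e \<bullet> (z - x - ?V) \<le> norm ?e * E" .
    show "?e \<bullet> (x - \<phi> u) \<le> norm ?e * (A\<^sup>2 / (2 * r))"
      using normal_inner_le[OF u ne x] by linarith
    have "\<bar>?e \<bullet> ?V\<bar> \<le> norm ?e * (norm c * DIM('a) * (A\<^sup>2 / r))"
      by (rule normal_combination_le) (use u ne y0 y in auto)
    then show "?e \<bullet> ?V \<le> norm ?e * (norm c * DIM('a) * (A\<^sup>2 / r))" by linarith
  qed
  finally show "?e \<bullet> ?e \<le> norm ?e * (E + A\<^sup>2 / (2 * r) + norm c * DIM('a) * (A\<^sup>2 / r))"
    by (simp only: distrib_left)
  show "0 \<le> E + A\<^sup>2 / (2 * r) + norm c * DIM('a) * (A\<^sup>2 / r)"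
    using order_trans[OF norm_ge_zero z] r_pos by simp
qed

text \<open>Within distance \<open>r / 2\<close> the touching balls alone give Lipschitz constant 2.
  The purpose is to make projections of close points close, so that the local estimate of
  \<open>closest_point_fine\<close> applies.\<close>

lemma closest_point_rough:
  assumes uv: "u \<in> U" "v \<in> U"
    and cl: "\<phi> u \<in> closest_points (\<phi> ` U) z" "\<phi> v \<in> closest_points (\<phi> ` U) z'"
    and \<epsilon>: "norm (z - \<phi> u) \<le> r / 2" "norm (z' - \<phi> v) \<le> r / 2"
  shows "norm (\<phi> v - \<phi> u) \<le> 2 * norm (z' - z)"
proof -
  have *: "(z - \<phi> u) \<bullet> (\<phi> v - \<phi> u) \<le> 1/4 * (norm (\<phi> v - \<phi> u))\<^sup>2"
    if "u \<in> U" "v \<in> U" "\<phi> u \<in> closest_points (\<phi> ` U) z" "norm (z - \<phi> u) \<le> r / 2" for u v z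
  proof -
    have "2 * r * ((z - \<phi> u) \<bullet> (\<phi> v - \<phi> u)) \<le> norm (z - \<phi> u) * (norm (\<phi> v - \<phi> u))\<^sup>2"
      using that closest_point_polar by (intro touching) auto
    also have "\<dots> \<le> r / 2 * (norm (\<phi> v - \<phi> u))\<^sup>2" using that by (intro mult_right_mono) auto
    finally show ?thesis using r_pos by (simp add: field_simps)
  qed
  have "(1 - 2 * (1/4)) * norm (\<phi> v - \<phi> u) \<le> norm (z' - z)"
    by (rule dist_le_of_obtuse) (use *[OF uv cl(1) \<epsilon>(1)] *[OF uv(2,1) cl(2) \<epsilon>(2)] in \<open>auto simp: norm_minus_commute\<close>)
  then show ?thesis by simp
qed

text \<open>The normal part of \<open>z - \<phi> u\<close> is treated by the touching ball, with the
  small norm \<open>G\<close>. The tangential part has a first-order contribution that is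
  nonpositive by \<open>closest_point_polar\<close>, and its second-order contribution carries the
  factor \<open>\<eta>\<close>, which compensates for its larger size
  \<open>\<epsilon>\<close>.\<close>

lemma closest_point_fine:
  assumes uv: "u \<in> U" "v \<in> U"
    and cl: "\<phi> u \<in> closest_points (\<phi> ` U) z" "\<phi> v \<in> closest_points (\<phi> ` U) z'"
    and G: "norm ((z - \<phi> u) - D u (T u (z - \<phi> u))) \<le> G" "norm ((z' - \<phi> v) - D v (T v (z' - \<phi> v))) \<le> G"
    and \<epsilon>: "norm (z - \<phi> u) \<le> \<epsilon>" "norm (z' - \<phi> v) \<le> \<epsilon>"
    and "\<eta> > 0"
    and \<delta>: "\<And>u v \<tau>. u \<in> U \<Longrightarrow> v \<in> U \<Longrightarrow> norm (v - u) < \<delta> \<Longrightarrow>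
      \<bar>D u \<tau> \<bullet> (\<phi> v - \<phi> u) - \<tau> \<bullet> (v - u)\<bar> \<le> \<eta> * norm \<tau> * (norm (v - u))\<^sup>2"
    and near: "norm (v - u) < \<delta>"
  shows "(1 - (G / r + 2 * \<eta> * \<epsilon> * L\<^sup>2)) * norm (\<phi> v - \<phi> u) \<le> norm (z' - z)"
proof -
  have *: "(z - \<phi> u) \<bullet> (\<phi> v - \<phi> u) \<le> (G / (2 * r) + \<eta> * \<epsilon> * L\<^sup>2) * (norm (\<phi> v - \<phi> u))\<^sup>2"
    if uv: "u \<in> U" "v \<in> U" and cl: "\<phi> u \<in> closest_points (\<phi> ` U) z"
      and G: "norm ((z - \<phi> u) - D u (T u (z - \<phi> u))) \<le> G" and \<epsilon>: "norm (z - \<phi> u) \<le> \<epsilon>"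
      and near: "norm (v - u) < \<delta>" for u v z
  proof -
    let ?n = "z - \<phi> u" and ?w = "v - u" and ?d = "norm (\<phi> v - \<phi> u)"
    let ?m = "?n - D u (T u ?n)"
    have "?m \<bullet> (\<phi> v - \<phi> u) \<le> norm ?m * (?d\<^sup>2 / (2 * r))"
      using normal_inner_le[OF uv(1) normal_part[OF uv(1)], of "\<phi> v" ?d ?n] uv by auto
    also have "\<dots> \<le> G * (?d\<^sup>2 / (2 * r))" using G r_pos by (intro mult_right_mono) auto
    finally have 1: "?m \<bullet> (\<phi> v - \<phi> u) \<le> G / (2 * r) * ?d\<^sup>2" by simp
    have "D u (T u ?n) \<bullet> (\<phi> v - \<phi> u) \<le> T u ?n \<bullet> ?w + \<eta> * norm (T u ?n) * (norm ?w)\<^sup>2"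
      using \<delta>[OF uv near, of "T u ?n"] by linarith
    also have "T u ?n \<bullet> ?w \<le> 0"
      unfolding T_inner by (rule closest_point_polar[OF uv cl])
    also have "\<eta> * norm (T u ?n) * (norm ?w)\<^sup>2 \<le> \<eta> * \<epsilon> * (L * ?d)\<^sup>2"
      using \<open>\<eta> > 0\<close> expansive[OF uv] norm_T_le[OF uv(1), of ?n] \<epsilon> order_trans[OF norm_ge_zero \<epsilon>]
      by (intro mult_mono power_mono) (auto simp: dist_norm norm_minus_commute intro: order_trans)
    finally have 2: "D u (T u ?n) \<bullet> (\<phi> v - \<phi> u) \<le> \<eta> * \<epsilon> * L\<^sup>2 * ?d\<^sup>2"
      by (simp add: power_mult_distrib mult.assoc)
    have "?n \<bullet> (\<phi> v - \<phi> u) = ?m \<bullet> (\<phi> v - \<phi> u) + D u (T u ?n) \<bullet> (\<phi> v - \<phi> u)"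
      unfolding inner_add_left [symmetric] by simp
    then show ?thesis using 1 2 by (simp add: distrib_right)
  qed
  have near': "norm (u - v) < \<delta>" using near by (simp add: norm_minus_commute)
  have "(1 - 2 * (G / (2 * r) + \<eta> * \<epsilon> * L\<^sup>2)) * norm (\<phi> v - \<phi> u) \<le> norm (z' - z)"
    by (rule dist_le_of_obtuse)
      (use *[OF uv cl(1) G(1) \<epsilon>(1) near] *[OF uv(2,1) cl(2) G(2) \<epsilon>(2) near'] in \<open>auto simp: norm_minus_commute\<close>)
  then show ?thesis by (simp add: algebra_simps)
qed

end

text \<open>The image under \<open>\<phi>1\<close> of the segment from \<open>p\<close> to
  \<open>q\<close> is sampled finely, and each sample is projected to the second surface. The steps
  are added up in the domain \<open>U2\<close>, where the intrinsic distance is Euclidean.\<close>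

lemma intrinsic_dist_comparison:
  fixes \<phi>1 :: "'a::euclidean_space \<Rightarrow> 'b::euclidean_space" and \<phi>2 :: "'a \<Rightarrow> 'b"
  defines "k \<equiv> real DIM('a)"
  assumes R1: "rolling_chart U1 \<phi>1 D1 K1 L1 r" and R2: "rolling_chart U2 \<phi>2 D2 K2 L2 r"
    and X: "X \<subseteq> \<phi>1 ` U1" "X \<subseteq> \<phi>2 ` U2" and cover: "\<And>z. z \<in> \<phi>1 ` U1 \<Longrightarrow> \<exists>x\<in>X. dist z x \<le> \<epsilon>"
    and wc: "\<And>x. x \<in> X \<Longrightarrow> \<exists>y0\<in>X. \<exists>y. norm (y0 - x) \<le> B * \<epsilon> \<and>
       (\<forall>b\<in>Basis. y b \<in> X \<and> norm (y b - x) \<le> B * \<epsilon>) \<and>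
       (\<forall>c::'a. \<mu> * \<epsilon> * norm c \<le> norm (\<Sum>b\<in>Basis. (c \<bullet> b) *\<^sub>R (y b - y0)))"
    and pos: "B > 0" "\<mu> > 0" "\<epsilon> > 0"
    and small: "\<epsilon> \<le> r / 2" "\<epsilon> * (2 * k * (B + 2)\<^sup>2) \<le> \<mu> * r"
    and \<kappa>: "\<kappa> = (B + 2)\<^sup>2 / r\<^sup>2 * (1 + 4 * (B + 2) * k / \<mu>) * \<epsilon>\<^sup>2" "\<kappa> < 1"
    and pq: "p \<in> U1" "q \<in> U1" "\<phi>1 p \<in> X" "\<phi>1 q \<in> X"
    and pq': "p' \<in> U2" "q' \<in> U2" "\<phi>2 p' = \<phi>1 p" "\<phi>2 q' = \<phi>1 q"
  shows "(1 - \<kappa>) * dist p' q' \<le> dist p q"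
proof -
  interpret c1: rolling_chart U1 \<phi>1 D1 K1 L1 r by fact
  interpret c2: rolling_chart U2 \<phi>2 D2 K2 L2 r by fact
  note r = c1.r_pos
  \<comment> \<open>This is the bound \<open>A\<^sup>2 / r * (1 + 2 * k * norm c)\<close> on the
    normal part, with \<open>A = (B + 2) * \<epsilon>\<close> and
    \<open>norm c \<le> 2 * A / (\<mu> * \<epsilon>)\<close>.\<close>
  define G where "G = (B + 2)\<^sup>2 / r * (1 + 4 * (B + 2) * k / \<mu>) * \<epsilon>\<^sup>2"
  have G_\<kappa>: "G / r = \<kappa>" using r by (simp add: G_def \<kappa>(1) power2_eq_square)
  have near_S2: "dist z (\<phi>2 a) \<le> \<epsilon>" if "z \<in> \<phi>1 ` U1" "\<phi>2 a \<in> closest_points (\<phi>2 ` U2) z" for z a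
  proof -
    obtain x where "x \<in> X" "dist z x \<le> \<epsilon>" using cover[OF \<open>z \<in> \<phi>1 ` U1\<close>] by blast
    then show ?thesis using that(2) X(2) by (force simp: closest_points_def)
  qed
  have normal_le: "norm ((z - \<phi>2 a) - D2 a (c2.T a (z - \<phi>2 a))) \<le> G"
    if z: "z \<in> \<phi>1 ` U1" and a: "a \<in> U2" "\<phi>2 a \<in> closest_points (\<phi>2 ` U2) z" for z a
  proof -
    \<comment> \<open>A frame point is within \<open>B * \<epsilon>\<close> of \<open>x\<close>,
      \<open>x\<close> within \<open>\<epsilon>\<close> of \<open>z\<close>, and \<open>z\<close>
      within \<open>\<epsilon>\<close> of its projection.\<close>
    define A where "A = (B + 2) * \<epsilon>"
    obtain u where u: "u \<in> U1" "z = \<phi>1 u" using z by blast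
    obtain x where x: "x \<in> X" "dist z x \<le> \<epsilon>" using cover[OF z] by blast
    obtain y0 y where y0: "y0 \<in> X" "norm (y0 - x) \<le> B * \<epsilon>"
      and y: "\<And>b. b \<in> Basis \<Longrightarrow> y b \<in> X" "\<And>b. b \<in> Basis \<Longrightarrow> norm (y b - x) \<le> B * \<epsilon>"
      and ind: "\<And>c::'a. \<mu> * \<epsilon> * norm c \<le> norm (\<Sum>b\<in>Basis. (c \<bullet> b) *\<^sub>R (y b - y0))"
      using wc[OF x(1)] by blast
    have za: "dist z (\<phi>2 a) \<le> \<epsilon>" using near_S2[OF z a(2)] .
    have close: "norm (w - z) \<le> A \<and> norm (w - \<phi>2 a) \<le> A" if "norm (w - x) \<le> B * \<epsilon>" for w
      using that x(2) za dist_triangle[of w z x] dist_triangle[of w "\<phi>2 a" z] pos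
      by (simp add: A_def dist_norm norm_minus_commute algebra_simps)
    have xc: "norm (x - z) \<le> A" "norm (x - \<phi>2 a) \<le> A" using close[of x] pos by auto
    have sm: "DIM('a) * (A\<^sup>2 / r) \<le> \<mu> * \<epsilon> / 2"
      using mult_right_mono[OF small(2), of \<epsilon>] pos r
      by (simp add: A_def k_def field_simps power2_eq_square)
    obtain c where c: "norm c \<le> 2 * A / (\<mu> * \<epsilon>)"
      "norm (\<phi>1 u - x - (\<Sum>b\<in>Basis. (c \<bullet> b) *\<^sub>R (y b - y0))) \<le> A\<^sup>2 / (2 * r) + norm c * DIM('a) * (A\<^sup>2 / r)"
    proof (rule c1.approx_by_combination[OF u(1), where ?y0.0=y0 and A=A and y=y and x=x and \<mu>="\<mu> * \<epsilon>"])
      show "y b \<in> \<phi>1 ` U1" "norm (y b - \<phi>1 u) \<le> A" if "b \<in> Basis" for b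
        using y that X close u by auto
      show "y0 \<in> \<phi>1 ` U1" "x \<in> \<phi>1 ` U1" "norm (y0 - \<phi>1 u) \<le> A" "norm (x - \<phi>1 u) \<le> A"
        using y0 x X xc close u by auto
    qed (use ind sm pos in auto)
    \<comment> \<open>The coefficients found on the first surface are reused on the second, with the
      same frame of points of \<open>X\<close>.\<close>
    have "norm ((z - \<phi>2 a) - D2 a (c2.T a (z - \<phi>2 a))) \<le>
       (A\<^sup>2 / (2 * r) + norm c * DIM('a) * (A\<^sup>2 / r)) + A\<^sup>2 / (2 * r) + norm c * DIM('a) * (A\<^sup>2 / r)"
      by (rule c2.normal_part_le[where x=x and y=y and ?y0.0=y0])
        (use c(2) u xc y0 y X x(1) close a in \<open>auto simp: subset_iff\<close>)
    also have "\<dots> = A\<^sup>2 / r * (1 + 2 * k * norm c)"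
      using r by (simp add: k_def field_simps)
    also have "\<dots> \<le> A\<^sup>2 / r * (1 + 2 * k * (2 * A / (\<mu> * \<epsilon>)))"
      using c(1) r by (intro mult_left_mono add_left_mono) (auto simp: k_def)
    also have "\<dots> = G"
      using pos r by (simp add: G_def A_def field_simps power2_eq_square)
    finally show ?thesis .
  qed
  have approx: "(1 - \<eta>) * (1 - (\<kappa> + 2 * \<eta> * \<epsilon> * L2\<^sup>2)) * dist p' q' \<le> dist p q"
    if \<eta>: "0 < \<eta>" "\<eta> < 1" "\<kappa> + 2 * \<eta> * \<epsilon> * L2\<^sup>2 \<le> 1" for \<eta>
  proof -
    obtain \<delta> where \<delta>: "\<delta> > 0" "\<And>u v \<tau>. u \<in> U2 \<Longrightarrow> v \<in> U2 \<Longrightarrow> norm (v - u) < \<delta> \<Longrightarrow>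
      \<bar>D2 u \<tau> \<bullet> (\<phi>2 v - \<phi>2 u) - \<tau> \<bullet> (v - u)\<bar> \<le> \<eta> * norm \<tau> * (norm (v - u))\<^sup>2"
      using c2.tangential_taylor[OF \<eta>(1)] by blast
    \<comment> \<open>For parameters closer than \<open>\<eta> / K2\<close>, chords of the second
      surface are at least \<open>1 - \<eta>\<close> times the parameter distance.\<close>
    define \<delta>' where "\<delta>' = min \<delta> (\<eta> / K2)"
    have \<delta>': "\<delta>' > 0" using \<delta> \<eta> c2.K_pos by (simp add: \<delta>'_def)
    \<comment> \<open>The rough Lipschitz constant 2 and \<open>L2\<close> convert the step
      \<open>dist p q / N\<close> into a bound on the distance of consecutive parameters
      \<open>a l\<close>.\<close>
    obtain N :: nat where N: "N > 0" "2 * L2 * dist p q / N < \<delta>'"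
    proof -
      obtain m :: nat where m: "2 * L2 * dist p q / \<delta>' < m" using reals_Archimedean2 by blast
      have "0 \<le> 2 * L2 * dist p q / \<delta>'" using \<delta>' c2.L_pos by simp
      then have "m > 0" using m by (metis less_le_trans not_gr_zero of_nat_0 not_le)
      then show thesis using m \<delta>' by (intro that[of m]) (auto simp: field_simps)
    qed
    define h where "h = dist p q / N"
    define P where "P l = p + (real l / real N) *\<^sub>R (q - p)" for l :: nat
    have PU: "P l \<in> U1" if "l \<le> N" for l
      using point_in_segment[of "real l / real N" p q] that N(1) pq(1,2) c1.convex convex_contains_segment
      by (auto simp: P_def)
    have Pstep: "norm (P (Suc l) - P l) = h" for l
      unfolding P_def h_def using N(1)
      by (simp add: scaleR_diff_left [symmetric] diff_divide_distrib [symmetric] dist_norm norm_minus_commute)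
    define z where "z l = \<phi>1 (P l)" for l
    have zS: "z l \<in> \<phi>1 ` U1" if "l \<le> N" for l using PU that by (simp add: z_def)
    have zstep: "norm (z (Suc l) - z l) \<le> h" if "l < N" for l
      using c1.norm_chord[of "P l" "P (Suc l)"] PU that Pstep[of l] by (simp add: z_def)
    have "\<exists>a. a \<in> U2 \<and> \<phi>2 a \<in> closest_points (\<phi>2 ` U2) w" for w
    proof -
      obtain y where "y \<in> closest_points (\<phi>2 ` U2) w"
        using closest_points_nonempty[OF c2.compact_image] c2.nonempty by blast
      then show ?thesis by (auto simp: closest_points_def)
    qed
    then have "\<exists>a. \<forall>l. a l \<in> U2 \<and> \<phi>2 (a l) \<in> closest_points (\<phi>2 ` U2) (z l)"
      by (intro choice allI)
    then obtain a where a: "\<And>l. a l \<in> U2" "\<And>l. \<phi>2 (a l) \<in> closest_points (\<phi>2 ` U2) (z l)"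
      by blast
    \<comment> \<open>A sample that already lies on the second surface is its own nearest point;
      this fixes the two ends of the chain.\<close>
    have at_X: "a l = b" if "b \<in> U2" "\<phi>2 b = z l" for l b
    proof -
      have "dist (z l) (\<phi>2 (a l)) \<le> dist (z l) (\<phi>2 b)" using a(2)[of l] that(1) unfolding closest_points_def by blast
      then have "\<phi>2 (a l) = \<phi>2 b" using that by simp
      then show ?thesis using inj_onD[OF c2.inj_on_chart] a(1) that(1) by blast
    qed
    have ends: "a 0 = p'" "a N = q'"
      using at_X[of p' 0] at_X[of q' N] pq' N(1) by (auto simp: z_def P_def)
    have step: "(1 - \<eta>) * (1 - (\<kappa> + 2 * \<eta> * \<epsilon> * L2\<^sup>2)) * dist (a l) (a (Suc l)) \<le> h" if l: "l < N" for l
    proof -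
      let ?d = "norm (\<phi>2 (a (Suc l)) - \<phi>2 (a l))" and ?w = "a (Suc l) - a l"
      have zz: "z l \<in> \<phi>1 ` U1" "z (Suc l) \<in> \<phi>1 ` U1" using zS l by auto
      have e: "norm (z l - \<phi>2 (a l)) \<le> \<epsilon>" "norm (z (Suc l) - \<phi>2 (a (Suc l))) \<le> \<epsilon>"
        using near_S2[OF zz(1) a(2)] near_S2[OF zz(2) a(2)] by (auto simp: dist_norm)
      have "?d \<le> 2 * norm (z (Suc l) - z l)"
        using e small(1) by (intro c2.closest_point_rough a) auto
      also have "\<dots> \<le> 2 * h" using zstep[OF l] by simp
      finally have rough: "?d \<le> 2 * h" .
      have "norm ?w \<le> L2 * ?d"
        using c2.expansive[OF a(1) a(1), of "Suc l" l] by (simp add: dist_norm)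
      also have "\<dots> \<le> L2 * (2 * h)" using rough c2.L_pos by (intro mult_left_mono) auto
      also have "\<dots> < \<delta>'" using N(2) by (simp add: h_def mult_ac)
      finally have w: "norm ?w < \<delta>" "norm ?w \<le> \<eta> / K2" by (auto simp: \<delta>'_def)
      have "(1 - (G / r + 2 * \<eta> * \<epsilon> * L2\<^sup>2)) * ?d \<le> norm (z (Suc l) - z l)"
        by (rule c2.closest_point_fine[OF a(1) a(1) a(2) a(2) normal_le[OF zz(1) a] normal_le[OF zz(2) a]
              e \<eta>(1) \<delta>(2) w(1)])
      also have "\<dots> \<le> h" by (rule zstep[OF l])
      finally have fine: "(1 - (\<kappa> + 2 * \<eta> * \<epsilon> * L2\<^sup>2)) * ?d \<le> h" unfolding G_\<kappa> .
      have "norm ?w = norm (D2 (a l) ?w)" by (simp add: c2.norm_D[OF a(1)])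
      also have "\<dots> \<le> ?d + norm (\<phi>2 (a (Suc l)) - \<phi>2 (a l) - D2 (a l) ?w)"
        using norm_triangle_ineq4[of "\<phi>2 (a (Suc l)) - \<phi>2 (a l)" "\<phi>2 (a (Suc l)) - \<phi>2 (a l) - D2 (a l) ?w"] by simp
      also have "\<dots> \<le> ?d + K2 * (norm ?w)\<^sup>2" using c2.taylor[OF a(1) a(1)] by simp
      also have "K2 * (norm ?w)\<^sup>2 \<le> \<eta> * norm ?w"
        using mult_right_mono[OF w(2) norm_ge_zero[of ?w]] c2.K_pos
        by (simp add: power2_eq_square field_simps)
      finally have "(1 - \<eta>) * norm ?w \<le> ?d" by (simp add: algebra_simps)
      then have "(1 - (\<kappa> + 2 * \<eta> * \<epsilon> * L2\<^sup>2)) * ((1 - \<eta>) * norm ?w) \<le> (1 - (\<kappa> + 2 * \<eta> * \<epsilon> * L2\<^sup>2)) * ?d"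
        using \<eta>(3) by (intro mult_left_mono) auto
      also note fine
      finally show ?thesis by (simp add: dist_norm norm_minus_commute mult_ac)
    qed
    have chain: "dist (a 0) (a m) \<le> (\<Sum>l<m. dist (a l) (a (Suc l)))" for m
    proof (induction m)
      case (Suc m)
      then show ?case using dist_triangle[of "a 0" "a (Suc m)" "a m"] by simp
    qed simp
    have nn: "0 \<le> (1 - \<eta>) * (1 - (\<kappa> + 2 * \<eta> * \<epsilon> * L2\<^sup>2))" using \<eta> by simp
    have "(1 - \<eta>) * (1 - (\<kappa> + 2 * \<eta> * \<epsilon> * L2\<^sup>2)) * dist p' q' \<le>
      (1 - \<eta>) * (1 - (\<kappa> + 2 * \<eta> * \<epsilon> * L2\<^sup>2)) * (\<Sum>l<N. dist (a l) (a (Suc l)))"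
      using chain[of N] unfolding ends by (intro mult_left_mono nn) auto
    also have "\<dots> \<le> (\<Sum>l<N. h)"
      unfolding sum_distrib_left by (intro sum_mono step) simp
    also have "\<dots> = dist p q" using N(1) by (simp add: h_def)
    finally show ?thesis .
  qed
  \<comment> \<open>The number of samples depends on \<open>\<eta>\<close> and on the second chart,
    but it has dropped out of \<open>approx\<close>. Letting \<open>\<eta>\<close> tend to 0 also
    removes \<open>L2\<close> and leaves \<open>\<kappa>\<close>.\<close>
  have lim: "((\<lambda>\<eta>. (1 - \<eta>) * (1 - (\<kappa> + 2 * \<eta> * \<epsilon> * L2\<^sup>2)) * dist p' q') \<longlongrightarrow>
     (1 - 0) * (1 - (\<kappa> + 2 * 0 * \<epsilon> * L2\<^sup>2)) * dist p' q') (at_right 0)"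
    by (intro tendsto_intros)
  have "((\<lambda>\<eta>. \<kappa> + 2 * \<eta> * \<epsilon> * L2\<^sup>2) \<longlongrightarrow> \<kappa> + 2 * 0 * \<epsilon> * L2\<^sup>2) (at_right (0::real))"
    by (intro tendsto_intros)
  then have "eventually (\<lambda>\<eta>. \<kappa> + 2 * \<eta> * \<epsilon> * L2\<^sup>2 < 1) (at_right (0::real))"
    using \<kappa>(2) by (intro order_tendstoD(2)) auto
  moreover have "eventually (\<lambda>\<eta>. 0 < \<eta> \<and> \<eta> < 1) (at_right (0::real))"
    unfolding eventually_at_right_field by (intro exI[of _ 1]) auto
  ultimately have "eventually (\<lambda>\<eta>. (1 - \<eta>) * (1 - (\<kappa> + 2 * \<eta> * \<epsilon> * L2\<^sup>2)) * dist p' q' \<le> dist p q) (at_right 0)"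
    by eventually_elim (intro approx, auto)
  from tendsto_upperbound[OF lim this] show ?thesis by simp
qed

section \<open>Procrustes perturbation\<close>

text \<open>Gram-Schmidt with error control, by induction on the number of vectors.\<close>

lemma almost_orthonormal_near_orthonormal:
  "\<exists>C>0. \<forall>(I::'i set) (b :: 'i \<Rightarrow> 'a::real_inner) \<delta>. finite I \<and> card I = n \<and> 0 \<le> \<delta> \<and> C * \<delta> \<le> 1 \<and>
     (\<forall>i\<in>I. \<forall>j\<in>I. \<bar>b i \<bullet> b j - (if i = j then 1 else 0)\<bar> \<le> \<delta>) \<longrightarrow>
     (\<exists>e. (\<forall>i\<in>I. \<forall>j\<in>I. e i \<bullet> e j = (if i = j then 1 else 0)) \<and> (\<forall>i\<in>I. norm (b i - e i) \<le> C * \<delta>))"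
proof (induction n)
  case 0
  show ?case by (intro exI[of _ 1]) auto
next
  case (Suc n)
  define P where "P C I b \<delta> \<longleftrightarrow>
     (\<exists>e. (\<forall>i\<in>I. \<forall>j\<in>I. e i \<bullet> e j = (if i = j then 1 else 0)) \<and> (\<forall>i\<in>I. norm (b i - e i) \<le> C * \<delta>))"
    for C \<delta> :: real and I :: "'i set" and b :: "'i \<Rightarrow> 'a"
  from Suc obtain C where C: "C > 0" and IH0: "\<forall>(I::'i set) (b :: 'i \<Rightarrow> 'a) \<delta>.
      finite I \<and> card I = n \<and> 0 \<le> \<delta> \<and> C * \<delta> \<le> 1 \<and>
      (\<forall>i\<in>I. \<forall>j\<in>I. \<bar>b i \<bullet> b j - (if i = j then 1 else 0)\<bar> \<le> \<delta>) \<longrightarrow> P C I b \<delta>"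
    unfolding P_def by (elim exE conjE)
  have IH: "P C I b \<delta>"
    if "finite I" "card I = n" "0 \<le> \<delta>" "C * \<delta> \<le> 1"
      "\<forall>i\<in>I. \<forall>j\<in>I. \<bar>b i \<bullet> b j - (if i = j then 1 else 0)\<bar> \<le> \<delta>" for I :: "'i set" and b :: "'i \<Rightarrow> 'a" and \<delta>
    using IH0[rule_format, of I \<delta> b] that by simp
  \<comment> \<open>\<open>H * \<delta>\<close> bounds the projection of the new vector to the span
    of the old ones: each of the \<open>n\<close> coefficients is at most \<open>\<delta>\<close>
    from the Gram matrix plus \<open>2 * (C * \<delta>)\<close> from replacing \<open>b l\<close> by
    \<open>e l\<close>. In \<open>C'\<close>, the part \<open>2 * H + 1\<close> is the error of the
    new vector (subtract the projection, then normalise), \<open>2 * H + 2\<close> keeps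
    \<open>norm w\<close> away from 0, and \<open>C\<close> serves the old vectors.\<close>
  define H where "H = n * (1 + 2 * C)"
  define C' where "C' = 2 * H + 2 + C"
  have H: "H \<ge> 0" using C by (simp add: H_def)
  have C': "C' > 0" "C \<le> C'" "2 * H + 1 \<le> C'" "2 * H + 2 \<le> C'" "1 \<le> C'" using H C by (auto simp: C'_def)
  show ?case
  proof (intro exI[of _ C'] conjI C' allI impI, elim conjE)
    fix I :: "'i set" and b :: "'i \<Rightarrow> 'a" and \<delta> :: real
    assume I: "finite I" "card I = Suc n" and \<delta>: "0 \<le> \<delta>" "C' * \<delta> \<le> 1"
      and gram: "\<forall>i\<in>I. \<forall>j\<in>I. \<bar>b i \<bullet> b j - (if i = j then 1 else 0)\<bar> \<le> \<delta>"
    obtain m J where J: "I = insert m J" "m \<notin> J" "card J = n" "finite J"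
      using I by (metis card_Suc_eq finite_insert)
    have le: "a * \<delta> \<le> 1" if "a \<le> C'" for a
      using mult_right_mono[OF that \<delta>(1)] \<delta>(2) by linarith
    have "\<delta> \<le> 1" using le[of 1] C' by simp
    obtain e where e: "\<forall>i\<in>J. \<forall>j\<in>J. e i \<bullet> e j = (if i = j then 1 else 0)" "\<forall>i\<in>J. norm (b i - e i) \<le> C * \<delta>"
      using IH[OF J(4,3) \<delta>(1) le[OF C'(2)], of b] gram unfolding J(1) P_def by auto
    have bm: "\<bar>(norm (b m))\<^sup>2 - 1\<bar> \<le> \<delta>" using gram J(1) by (auto simp: power2_norm_eq_inner)
    have nb1: "\<bar>norm (b m) - 1\<bar> \<le> \<delta>"
    proof -
      have "\<bar>norm (b m) - 1\<bar> * 1 \<le> \<bar>norm (b m) - 1\<bar> * \<bar>norm (b m) + 1\<bar>" by (intro mult_left_mono) auto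
      also have "\<dots> = \<bar>(norm (b m))\<^sup>2 - 1\<bar>" unfolding abs_mult [symmetric] by (simp add: power2_eq_square algebra_simps)
      finally show ?thesis using bm by simp
    qed
    then have nb: "norm (b m) \<le> 2" using \<open>\<delta> \<le> 1\<close> by linarith
    have co: "\<bar>b m \<bullet> e l\<bar> \<le> (1 + 2 * C) * \<delta>" if l: "l \<in> J" for l
    proof -
      have "b m \<bullet> e l = b m \<bullet> b l - b m \<bullet> (b l - e l)" by (simp add: inner_diff_right)
      moreover have "\<bar>b m \<bullet> b l - (if m = l then 1 else 0)\<bar> \<le> \<delta>" using gram J(1) l by blast
      then have "\<bar>b m \<bullet> b l\<bar> \<le> \<delta>" using l J(2) by (auto split: if_splits)
      moreover have "\<bar>b m \<bullet> (b l - e l)\<bar> \<le> 2 * (C * \<delta>)"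
        using e(2) l nb C \<delta> by (intro order_trans[OF Cauchy_Schwarz_ineq2 mult_mono]) auto
      ultimately have "\<bar>b m \<bullet> e l\<bar> \<le> \<delta> + 2 * (C * \<delta>)" by linarith
      then show ?thesis by (simp add: algebra_simps)
    qed
    define p where "p = (\<Sum>l\<in>J. (b m \<bullet> e l) *\<^sub>R e l)"
    define w where "w = b m - p"
    have "norm p \<le> (\<Sum>l\<in>J. norm ((b m \<bullet> e l) *\<^sub>R e l))" unfolding p_def by (rule norm_sum)
    also have "\<dots> \<le> (\<Sum>l\<in>J. (1 + 2 * C) * \<delta>)"
    proof (intro sum_mono)
      fix l assume l: "l \<in> J"
      then have "norm (e l) = 1" using e(1) by (simp add: norm_eq_1)
      then show "norm ((b m \<bullet> e l) *\<^sub>R e l) \<le> (1 + 2 * C) * \<delta>" using co[OF l] by simp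
    qed
    finally have p: "norm p \<le> H * \<delta>" by (simp add: J(3) H_def)
    have nw: "\<bar>norm w - 1\<bar> \<le> (H + 1) * \<delta>"
      using nb1 p norm_triangle_ineq3[of w "b m"] by (simp add: w_def algebra_simps)
    have "(2 * H + 2) * \<delta> \<le> 1" by (rule le) (rule C')
    then have "2 * ((H + 1) * \<delta>) \<le> 1" by (simp add: algebra_simps)
    then have w: "norm w > 0" using nw by linarith
    have w_orth: "w \<bullet> e l = 0" if l: "l \<in> J" for l
    proof -
      have "p \<bullet> e l = (\<Sum>l'\<in>J. if l' = l then b m \<bullet> e l' else 0)"
        unfolding p_def inner_sum_left using e(1) l by (intro sum.cong) auto
      also have "\<dots> = b m \<bullet> e l" using l J(4) by simp
      finally show ?thesis by (simp add: w_def inner_diff_left)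
    qed
    define e' where "e' = e(m := w /\<^sub>R norm w)"
    have em: "norm (b m - e' m) \<le> C' * \<delta>"
    proof -
      have "w - w /\<^sub>R norm w = (1 - inverse (norm w)) *\<^sub>R w" by (simp add: scaleR_diff_left)
      then have "norm (w - w /\<^sub>R norm w) = \<bar>(1 - inverse (norm w)) * norm w\<bar>" by (simp add: abs_mult)
      also have "(1 - inverse (norm w)) * norm w = norm w - 1" using w by (simp add: left_diff_distrib)
      finally have "norm (w - w /\<^sub>R norm w) \<le> (H + 1) * \<delta>" using nw by simp
      moreover have "b m - e' m = p + (w - w /\<^sub>R norm w)" by (simp add: e'_def w_def)
      ultimately have "norm (b m - e' m) \<le> H * \<delta> + (H + 1) * \<delta>"
        using p by (metis add_mono norm_triangle_ineq order_trans)
      also have "\<dots> = (2 * H + 1) * \<delta>" by (simp add: algebra_simps)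
      also have "\<dots> \<le> C' * \<delta>" by (intro mult_right_mono C' \<delta>)
      finally show ?thesis .
    qed
    have e'J: "e' l = e l" if "l \<in> J" for l using that J(2) by (auto simp: e'_def)
    have "e' m \<bullet> e' m = 1" using w by (simp add: e'_def power2_norm_eq_inner [symmetric] power2_eq_square flip: norm_eq_1)
    moreover have "e' m \<bullet> e' l = 0" "e' l \<bullet> e' m = 0" if "l \<in> J" for l
      using w_orth[OF that] e'J[OF that] by (auto simp: e'_def inner_commute)
    ultimately have "\<forall>i\<in>I. \<forall>j\<in>I. e' i \<bullet> e' j = (if i = j then 1 else 0)"
      using e(1) e'J J(2) unfolding J(1) by auto
    moreover have "norm (b i - e' i) \<le> C' * \<delta>" if "i \<in> I" for i
    proof (cases "i = m")
      case False
      then have "i \<in> J" using that J(1) by simp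
      then have "norm (b i - e' i) \<le> C * \<delta>" using e(2) e'J by simp
      also have "\<dots> \<le> C' * \<delta>" by (intro mult_right_mono C' \<delta>)
      finally show ?thesis .
    qed (use em in simp)
    ultimately show "\<exists>e. (\<forall>i\<in>I. \<forall>j\<in>I. e i \<bullet> e j = (if i = j then 1 else 0)) \<and> (\<forall>i\<in>I. norm (b i - e i) \<le> C' * \<delta>)"
      by blast
  qed
qed

text \<open>Polarisation expresses the inner products by squared distances, and a squared distance
  changes by at most \<open>\<delta>\<close> times a sum of two distances, which is at most
  \<open>2 * R + 1\<close>.\<close>

lemma gram_perturbation:
  fixes u v :: "'i \<Rightarrow> 'a::real_inner"
  assumes "\<And>i j. i \<in> J \<Longrightarrow> j \<in> J \<Longrightarrow> \<bar>dist (v i) (v j) - dist (u i) (u j)\<bar> \<le> \<delta>"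
    and "\<And>i j. i \<in> J \<Longrightarrow> j \<in> J \<Longrightarrow> dist (u i) (u j) \<le> R" and "0 \<le> \<delta>" "\<delta> \<le> 1"
    and "i \<in> J" "j \<in> J" "i0 \<in> J"
  shows "\<bar>(v i - v i0) \<bullet> (v j - v i0) - (u i - u i0) \<bullet> (u j - u i0)\<bar> \<le> 2 * (2 * R + 1) * \<delta>"
proof -
  have sq: "\<bar>(dist (v i) (v j))\<^sup>2 - (dist (u i) (u j))\<^sup>2\<bar> \<le> (2 * R + 1) * \<delta>" if "i \<in> J" "j \<in> J" for i j
  proof -
    have "\<bar>(dist (v i) (v j))\<^sup>2 - (dist (u i) (u j))\<^sup>2\<bar> =
       (dist (v i) (v j) + dist (u i) (u j)) * \<bar>dist (v i) (v j) - dist (u i) (u j)\<bar>"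
      by (simp add: power2_eq_square square_diff_square_factored abs_mult)
    also have "\<dots> \<le> (2 * R + 1) * \<delta>"
      using assms(1,2)[OF that] \<open>\<delta> \<le> 1\<close> order_trans[OF zero_le_dist assms(2)[OF that]]
      by (intro mult_mono) auto
    finally show ?thesis .
  qed
  have polar: "(w i - w i0) \<bullet> (w j - w i0) = ((dist (w i) (w i0))\<^sup>2 + (dist (w j) (w i0))\<^sup>2 - (dist (w i) (w j))\<^sup>2) / 2"
    for w :: "'i \<Rightarrow> 'a"
    unfolding dist_norm power2_norm_eq_inner by (simp add: inner_diff_left inner_diff_right inner_commute algebra_simps)
  have "\<bar>(p + q - r) / 2 - (p' + q' - r') / 2\<bar> \<le> 2 * e"
    if "\<bar>p - p'\<bar> \<le> e" "\<bar>q - q'\<bar> \<le> e" "\<bar>r - r'\<bar> \<le> e" for p p' q q' r r' e :: real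
    using that by (simp add: abs_le_iff field_simps)
  from this[OF sq[OF assms(5,7)] sq[OF assms(6,7)] sq[OF assms(5,6)]]
  show ?thesis unfolding polar by (simp only: mult.assoc)
qed

text \<open>The anchors give a frame of \<open>u\<close> in which basis vectors have bounded
  coordinates. The same coordinates in the frame of \<open>v\<close> produce almost orthonormal
  vectors, since the Gram matrices nearly agree; orthonormalising them defines \<open>f\<close>.
  Every other point is located by its inner products with the frame, so the constant does not grow
  with the number of points, and \<open>\<delta> = 0\<close> yields an exact congruence.\<close>

lemma procrustes:
  fixes \<mu> R :: real
  assumes "\<mu> > 0" "R \<ge> 0"
  shows "\<exists>C>0. \<forall>(J::'i set) (u::'i \<Rightarrow> 'a::euclidean_space) (v::'i \<Rightarrow> 'a) \<delta> i0 (a :: 'a \<Rightarrow> 'i). 0 \<le> \<delta> \<and> C * \<delta> \<le> 1 \<and>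
     (\<forall>i\<in>J. \<forall>j\<in>J. \<bar>dist (v i) (v j) - dist (u i) (u j)\<bar> \<le> \<delta>) \<and>
     (\<forall>i\<in>J. \<forall>j\<in>J. dist (u i) (u j) \<le> R) \<and> i0 \<in> J \<and> (\<forall>b\<in>Basis. a b \<in> J) \<and>
     (\<forall>c::'a. \<mu> * norm c \<le> norm (\<Sum>b\<in>Basis. (c \<bullet> b) *\<^sub>R (u (a b) - u i0))) \<longrightarrow>
     (\<exists>f t. orthogonal_transformation f \<and> (\<forall>i\<in>J. norm (v i - (f (u i) + t)) \<le> C * \<delta>))"
proof -
  define k where "k = real DIM('a)"
  have k: "k \<ge> 1" using DIM_positive[where 'a='a] by (simp add: k_def)
  obtain C0 where C0: "C0 > 0" and GS: "\<And>(b :: 'a \<Rightarrow> 'a) \<delta>. 0 \<le> \<delta> \<Longrightarrow> C0 * \<delta> \<le> 1 \<Longrightarrow>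
     \<forall>i\<in>Basis. \<forall>j\<in>Basis. \<bar>b i \<bullet> b j - (if i = j then 1 else 0)\<bar> \<le> \<delta> \<Longrightarrow>
     \<exists>e. (\<forall>i\<in>Basis. \<forall>j\<in>Basis. e i \<bullet> e j = (if i = j then 1 else 0)) \<and> (\<forall>i\<in>Basis. norm (b i - e i) \<le> C0 * \<delta>)"
    using almost_orthonormal_near_orthonormal[of "DIM('a)", where 'i='a and 'a='a] by (metis finite_Basis)
  define g where "g = 2 * (2 * R + 1)"
  \<comment> \<open>\<open>h * \<delta>\<close> is the Gram error of the transported basis: two
    frame expansions give \<open>k\<^sup>2\<close>, two coordinate vectors of norm at most
    \<open>1 / \<mu>\<close> give the denominator. \<open>H * \<delta>\<close> is the resulting
    error of one coordinate. \<open>C\<close> sums over \<open>k\<close> coordinates and secures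
    \<open>\<delta> \<le> 1\<close> and \<open>C0 * (h * \<delta>) \<le> 1\<close>.\<close>
  define h where "h = k\<^sup>2 * g / \<mu>\<^sup>2"
  define H where "H = k * g / \<mu> + (R + 1) * (C0 * h)"
  define C where "C = 1 + C0 * h + k * H"
  have g: "g > 0" and h: "h > 0" using assms k by (auto simp: g_def h_def)
  have H: "H > 0" using g h C0 assms k by (auto simp: H_def intro!: add_pos_nonneg)
  have C: "C > 0" "C0 * h \<le> C" "1 \<le> C" "k * H \<le> C"
    using h C0 H k by (auto simp: C_def intro!: add_pos_nonneg add_nonneg_nonneg)
  show ?thesis
  proof (intro exI[of _ C] conjI C allI impI, elim conjE)
    fix J :: "'i set" and u v :: "'i \<Rightarrow> 'a" and \<delta> :: real and i0 :: 'i and a :: "'a \<Rightarrow> 'i"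
    assume \<delta>: "0 \<le> \<delta>" "C * \<delta> \<le> 1"
      and dists: "\<forall>i\<in>J. \<forall>j\<in>J. \<bar>dist (v i) (v j) - dist (u i) (u j)\<bar> \<le> \<delta>"
      and R: "\<forall>i\<in>J. \<forall>j\<in>J. dist (u i) (u j) \<le> R" and i0: "i0 \<in> J" and a: "\<forall>b\<in>Basis. a b \<in> J"
      and wc: "\<forall>c::'a. \<mu> * norm c \<le> norm (\<Sum>b\<in>Basis. (c \<bullet> b) *\<^sub>R (u (a b) - u i0))"
    have le: "A * \<delta> \<le> 1" if "A \<le> C" for A
      using mult_right_mono[OF that \<delta>(1)] \<delta>(2) by linarith
    have \<delta>1: "\<delta> \<le> 1" using le[of 1] C by simp
    have gram: "\<bar>(v i - v i0) \<bullet> (v j - v i0) - (u i - u i0) \<bullet> (u j - u i0)\<bar> \<le> g * \<delta>" if "i \<in> J" "j \<in> J" for i j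
      unfolding g_def by (rule gram_perturbation[where J=J]) (use dists R \<delta> \<delta>1 that i0 in auto)
    define A where "A w c = (\<Sum>b\<in>Basis. (c \<bullet> b) *\<^sub>R (w (a b) - w i0))" for w :: "'i \<Rightarrow> 'a" and c :: 'a
    have linA: "linear (A w)" for w
      unfolding A_def by (rule linearI) (auto simp: inner_add_left scaleR_add_left sum.distrib scaleR_sum_right)
    have A1: "\<bar>(v i - v i0) \<bullet> A v c - (u i - u i0) \<bullet> A u c\<bar> \<le> k * norm c * (g * \<delta>)" if "i \<in> J" for i c
    proof -
      have "(v i - v i0) \<bullet> A v c - (u i - u i0) \<bullet> A u c =
        (\<Sum>b\<in>Basis. (c \<bullet> b) * ((v i - v i0) \<bullet> (v (a b) - v i0) - (u i - u i0) \<bullet> (u (a b) - u i0)))"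
        by (simp add: A_def inner_sum_right sum_subtractf right_diff_distrib)
      also have "\<bar>\<dots>\<bar> \<le> (\<Sum>b\<in>(Basis::'a set). norm c * (g * \<delta>))"
        using a that by (intro sum_abs[THEN order_trans] sum_mono) (auto simp: abs_mult intro!: mult_mono Basis_le_norm gram)
      finally show ?thesis by (simp add: k_def)
    qed
    have A2: "\<bar>A v c \<bullet> A v c' - A u c \<bullet> A u c'\<bar> \<le> k\<^sup>2 * norm c * norm c' * (g * \<delta>)" for c c'
    proof -
      have "A v c \<bullet> A v c' - A u c \<bullet> A u c' =
        (\<Sum>b\<in>Basis. (c \<bullet> b) * ((v (a b) - v i0) \<bullet> A v c' - (u (a b) - u i0) \<bullet> A u c'))"
        unfolding A_def[of _ c] by (simp add: inner_sum_left sum_subtractf right_diff_distrib)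
      also have "\<bar>\<dots>\<bar> \<le> (\<Sum>b\<in>(Basis::'a set). norm c * (k * norm c' * (g * \<delta>)))"
        using a by (intro sum_abs[THEN order_trans] sum_mono) (auto simp: abs_mult intro!: mult_mono Basis_le_norm A1)
      finally show ?thesis by (simp add: k_def power2_eq_square mult_ac)
    qed
    have wcA: "\<mu> * norm c \<le> norm (A u c)" for c using wc by (simp add: A_def)
    have "inj (A u)"
    proof (rule injI)
      fix c c' assume "A u c = A u c'"
      then have "A u (c - c') = 0" by (simp add: linear_diff[OF linA])
      then show "c = c'" using wcA[of "c - c'"] \<open>\<mu> > 0\<close> by (simp add: mult_le_0_iff)
    qed
    then have "surj (A u)" using linear_injective_imp_surjective[OF linA] by blast
    \<comment> \<open>\<open>G b\<close> holds the coordinates of \<open>b\<close> in the frame of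
      \<open>u\<close>; \<open>A v (G b)\<close> is the candidate for the image of
      \<open>b\<close>.\<close>
    then obtain G where G: "\<And>b. A u (G b) = b" by (metis surjD)
    have nG: "norm (G b) \<le> 1 / \<mu>" if "b \<in> Basis" for b
      using wcA[of "G b"] G[of b] that \<open>\<mu> > 0\<close> by (simp add: field_simps)
    have "\<bar>A v (G b) \<bullet> A v (G b') - (if b = b' then 1 else 0)\<bar> \<le> h * \<delta>" if b: "b \<in> Basis" "b' \<in> Basis" for b b'
    proof -
      have "\<bar>A v (G b) \<bullet> A v (G b') - b \<bullet> b'\<bar> \<le> k\<^sup>2 * norm (G b) * norm (G b') * (g * \<delta>)"
        using A2[of "G b" "G b'"] by (simp add: G)
      also have "\<dots> \<le> k\<^sup>2 * (1 / \<mu>) * (1 / \<mu>) * (g * \<delta>)"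
        using nG b assms g \<delta> by (intro mult_mono) auto
      finally show ?thesis using b by (simp add: inner_Basis h_def power2_eq_square)
    qed
    moreover have "0 \<le> h * \<delta>" "C0 * (h * \<delta>) \<le> 1"
      using h \<delta> le[OF C(2)] by (auto simp: mult.assoc)
    ultimately obtain e where e: "\<forall>i\<in>Basis. \<forall>j\<in>Basis. e i \<bullet> e j = (if i = j then 1 else 0)"
      "\<forall>i\<in>Basis. norm (A v (G i) - e i) \<le> C0 * (h * \<delta>)"
      using GS[of "h * \<delta>" "\<lambda>b. A v (G b)"] by blast
    define f where "f x = (\<Sum>b\<in>Basis. (x \<bullet> b) *\<^sub>R e b)" for x :: 'a
    have linf: "linear f"
      unfolding f_def by (rule linearI) (auto simp: inner_add_left scaleR_add_left sum.distrib scaleR_sum_right)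
    have f_inner: "f x \<bullet> e b = x \<bullet> b" if b: "b \<in> Basis" for x b
    proof -
      have "f x \<bullet> e b = (\<Sum>b'\<in>Basis. if b' = b then x \<bullet> b' else 0)"
        unfolding f_def inner_sum_left using e(1) b by (intro sum.cong) auto
      then show ?thesis using b by simp
    qed
    have "f x \<bullet> f y = x \<bullet> y" for x y
    proof -
      have "f x \<bullet> f y = (\<Sum>b\<in>Basis. (y \<bullet> b) * (f x \<bullet> e b))" unfolding f_def[of y] by (simp add: inner_sum_right)
      also have "\<dots> = (\<Sum>b\<in>Basis. (y \<bullet> b) * (x \<bullet> b))" using f_inner by simp
      also have "\<dots> = x \<bullet> y" by (subst (3) euclidean_inner) (simp add: mult.commute)
      finally show ?thesis .
    qed
    then have of: "orthogonal_transformation f" using linf by (simp add: orthogonal_transformation_def)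
    have main: "norm ((v i - v i0) - f (u i - u i0)) \<le> C * \<delta>" if i: "i \<in> J" for i
    proof -
      let ?y = "v i - v i0" and ?x = "u i - u i0"
      \<comment> \<open>Pulling \<open>?y\<close> back by the isometry \<open>f\<close> turns the
        error into a difference of coordinates.\<close>
      obtain x' where x': "f x' = ?y" using orthogonal_transformation_surj[OF of] by (metis surjD)
      have ny: "norm ?y \<le> R + 1"
      proof -
        have "\<bar>dist (v i) (v i0) - dist (u i) (u i0)\<bar> \<le> \<delta>" "dist (u i) (u i0) \<le> R"
          using dists R i i0 by blast+
        then show ?thesis using \<delta>1 unfolding dist_norm by linarith
      qed
      have coord: "\<bar>(x' - ?x) \<bullet> b\<bar> \<le> H * \<delta>" if b: "b \<in> Basis" for b
      proof -
        have "\<bar>?y \<bullet> A v (G b) - ?x \<bullet> b\<bar> \<le> k * norm (G b) * (g * \<delta>)"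
          using A1[OF i, of "G b"] by (simp add: G)
        also have "\<dots> \<le> k * (1 / \<mu>) * (g * \<delta>)"
          using nG[OF b] k g \<delta> assms by (intro mult_mono) auto
        finally have 1: "\<bar>?y \<bullet> A v (G b) - ?x \<bullet> b\<bar> \<le> k * g / \<mu> * \<delta>" by simp
        have 2: "\<bar>?y \<bullet> (A v (G b) - e b)\<bar> \<le> (R + 1) * (C0 * (h * \<delta>))"
          using ny e(2) b assms by (intro order_trans[OF Cauchy_Schwarz_ineq2 mult_mono]) auto
        have "x' \<bullet> b = ?y \<bullet> e b" using f_inner[OF b, of x'] x' by simp
        also have "\<dots> = ?y \<bullet> A v (G b) - ?y \<bullet> (A v (G b) - e b)" by (simp add: inner_diff_right)
        finally have "\<bar>(x' - ?x) \<bullet> b\<bar> \<le> k * g / \<mu> * \<delta> + (R + 1) * (C0 * (h * \<delta>))"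
          using 1 2 unfolding inner_diff_left[of x' ?x b] by linarith
        then show ?thesis by (simp add: H_def algebra_simps)
      qed
      have "norm (?y - f ?x) = norm (x' - ?x)"
        using orthogonal_transformation_norm[OF of, of "x' - ?x"] x' by (simp add: linear_diff[OF linf])
      also have "\<dots> \<le> (\<Sum>b\<in>Basis. \<bar>(x' - ?x) \<bullet> b\<bar>)" by (rule norm_le_l1)
      also have "\<dots> \<le> (\<Sum>b\<in>(Basis::'a set). H * \<delta>)" by (intro sum_mono coord)
      also have "\<dots> = k * H * \<delta>" by (simp add: k_def)
      also have "\<dots> \<le> C * \<delta>" by (intro mult_right_mono C \<delta>)
      finally show ?thesis .
    qed
    show "\<exists>f t. orthogonal_transformation f \<and> (\<forall>i\<in>J. norm (v i - (f (u i) + t)) \<le> C * \<delta>)"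
    proof (intro exI[of _ f] exI[of _ "v i0 - f (u i0)"] conjI ballI of)
      fix i assume "i \<in> J"
      then show "norm (v i - (f (u i) + (v i0 - f (u i0)))) \<le> C * \<delta>"
        using main[of i] by (simp add: linear_diff[OF linf] algebra_simps)
    qed
  qed
qed

section \<open>Well-conditioned frames with vertices in the covering\<close>

context regular_chart
begin

text \<open>The vertices of an orthogonal frame in a ball of \<open>U\<close> are replaced by
  parameters of nearby points of \<open>X\<close>. Each moves by at most
  \<open>L * \<epsilon>\<close>, so a frame vector changes by at most
  \<open>2 * (L * \<epsilon>)\<close>; summed over the dimension this is at most half of
  \<open>s\<close>, whence the condition on \<open>s\<close>.\<close>

lemma well_conditioned_anchors:
  assumes ball: "cball p s \<subseteq> U" and s: "s > 0" "4 * L * \<epsilon> * DIM('a) \<le> s"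
    and cover: "\<And>z. z \<in> \<phi> ` U \<Longrightarrow> \<exists>x\<in>X. dist z x \<le> \<epsilon>" and X: "X \<subseteq> \<phi> ` U"
  obtains q0 q where "q0 \<in> U" "\<phi> q0 \<in> X" "norm (q0 - p) \<le> L * \<epsilon>"
    "\<And>b. b \<in> Basis \<Longrightarrow> q b \<in> U \<and> \<phi> (q b) \<in> X \<and> norm (q b - p) \<le> s + L * \<epsilon>"
    "\<And>c::'a. s / 2 * norm c \<le> norm (\<Sum>b\<in>Basis. (c \<bullet> b) *\<^sub>R (q b - q0))"
proof -
  have near: "\<exists>q\<in>U. \<phi> q \<in> X \<and> norm (q - w) \<le> L * \<epsilon>" if w: "w \<in> U" for w
  proof -
    obtain q where q: "q \<in> U" "\<phi> q \<in> X" "dist (\<phi> w) (\<phi> q) \<le> \<epsilon>"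
      using cover[of "\<phi> w"] w X by blast
    have "dist w q \<le> L * \<epsilon>"
      using expansive[OF w q(1)] mult_left_mono[OF q(3), of L] L_pos by linarith
    then show ?thesis using q by (auto simp: dist_norm norm_minus_commute)
  qed
  then obtain F where F: "\<And>w. w \<in> U \<Longrightarrow> F w \<in> U \<and> \<phi> (F w) \<in> X \<and> norm (F w - w) \<le> L * \<epsilon>"
    by metis
  have pU: "p \<in> U" using ball s by auto
  have bU: "p + s *\<^sub>R b \<in> U" if "b \<in> Basis" for b :: 'a
    using ball s that by (auto simp: dist_norm subset_iff)
  let ?q = "\<lambda>b. F (p + s *\<^sub>R b)"
  have close: "norm ((?q b - F p) - s *\<^sub>R b) \<le> 2 * (L * \<epsilon>)" if "b \<in> Basis" for b
  proof -
    have e: "(?q b - F p) - s *\<^sub>R b = (?q b - (p + s *\<^sub>R b)) - (F p - p)" by simp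
    have "norm (?q b - (p + s *\<^sub>R b)) \<le> L * \<epsilon>" "norm (F p - p) \<le> L * \<epsilon>"
      using F[OF bU[OF that]] F[OF pU] by auto
    then show ?thesis
      unfolding e using norm_triangle_ineq4[of "?q b - (p + s *\<^sub>R b)" "F p - p"] by linarith
  qed
  have "s / 2 * norm c \<le> norm (\<Sum>b\<in>Basis. (c \<bullet> b) *\<^sub>R (?q b - F p))" for c :: 'a
  proof -
    let ?e = "\<Sum>b\<in>Basis. (c \<bullet> b) *\<^sub>R ((?q b - F p) - s *\<^sub>R b)"
    have "norm ?e \<le> (\<Sum>b\<in>(Basis::'a set). norm c * (2 * (L * \<epsilon>)))"
      using close by (intro sum_norm_le) (auto intro!: mult_mono Basis_le_norm)
    also have "\<dots> \<le> norm c * (s / 2)"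
      using mult_left_mono[OF s(2), of "norm c / 2"] by (simp add: mult_ac)
    finally have "norm ?e \<le> norm c * (s / 2)" .
    moreover have "(\<Sum>b\<in>Basis. (c \<bullet> b) *\<^sub>R (s *\<^sub>R b)) = s *\<^sub>R c"
      using euclidean_representation[of "s *\<^sub>R c"] by (simp add: mult.commute)
    then have "(\<Sum>b\<in>Basis. (c \<bullet> b) *\<^sub>R (?q b - F p)) = s *\<^sub>R c + ?e"
      by (simp add: scaleR_diff_right sum_subtractf)
    ultimately show ?thesis
      using norm_triangle_ineq4[of "s *\<^sub>R c + ?e" ?e] s(1) by (simp add: algebra_simps)
  qed
  moreover have "norm (?q b - p) \<le> s + L * \<epsilon>" if "b \<in> Basis" for b
  proof -
    have "?q b - p = s *\<^sub>R b + (?q b - (p + s *\<^sub>R b))" by simp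
    then show ?thesis
      using F[OF bU[OF that]] norm_triangle_ineq[of "s *\<^sub>R b" "?q b - (p + s *\<^sub>R b)"] that s(1) by simp
  qed
  ultimately show thesis
    using F[OF pU] F bU by (intro that[of "F p" ?q]) auto
qed

text \<open>By convexity, the homothety with centre \<open>u\<close> and ratio
  \<open>\<theta> * \<epsilon>\<close> maps \<open>cball p0 \<rho>\<close> into \<open>U\<close>,
  wherever \<open>u\<close> lies. The choice of \<open>\<theta>\<close> makes the new radius the
  smallest one that \<open>well_conditioned_anchors\<close> allows. \<open>B\<close> collects the
  distance from \<open>u\<close> to the new centre, the radius and the shift to points of
  \<open>X\<close>.\<close>

lemma local_well_conditioned_anchors:
  assumes ball: "cball p0 \<rho> \<subseteq> U" and "\<rho> > 0" and "\<epsilon> > 0"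
    and cover: "\<And>z. z \<in> \<phi> ` U \<Longrightarrow> \<exists>x\<in>X. dist z x \<le> \<epsilon>" and X: "X \<subseteq> \<phi> ` U"
    and \<theta>: "\<theta> = 4 * L * DIM('a) / \<rho>" and B: "B = \<theta> * (diameter U + \<rho>) + L"
    and small: "\<theta> * \<epsilon> \<le> 1" "2 * K * B\<^sup>2 * \<epsilon> \<le> L"
    and x: "x \<in> X"
  shows "\<exists>y0\<in>X. \<exists>y. norm (y0 - x) \<le> B * \<epsilon> \<and>
       (\<forall>b\<in>Basis. y b \<in> X \<and> norm (y b - x) \<le> B * \<epsilon>) \<and>
       (\<forall>c::'a. L * DIM('a) * \<epsilon> * norm c \<le> norm (\<Sum>b\<in>Basis. (c \<bullet> b) *\<^sub>R (y b - y0)))"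
proof -
  have \<theta>0: "\<theta> > 0" using L_pos \<open>\<rho> > 0\<close> by (simp add: \<theta>)
  obtain u where u: "u \<in> U" "x = \<phi> u" using x X by blast
  define t where "t = \<theta> * \<epsilon>"
  have t: "0 < t" "t \<le> 1" using \<theta>0 \<open>\<epsilon> > 0\<close> small by (auto simp: t_def)
  define p where "p = u + t *\<^sub>R (p0 - u)"
  have ball': "cball p (t * \<rho>) \<subseteq> U"
  proof
    fix w assume w: "w \<in> cball p (t * \<rho>)"
    define v where "v = p0 + (w - p) /\<^sub>R t"
    have "norm (w - p) \<le> t * \<rho>" using w by (simp add: dist_norm norm_minus_commute)
    then have "inverse t * norm (w - p) \<le> \<rho>" using t by (simp add: field_simps)
    then have "norm ((w - p) /\<^sub>R t) \<le> \<rho>" using t by simp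
    then have "v \<in> U" using ball by (auto simp: v_def dist_norm)
    moreover have "w = u + t *\<^sub>R (v - u)" using t by (simp add: v_def p_def algebra_simps)
    ultimately show "w \<in> U"
      using point_in_segment[of t u v] t u convex convex_contains_segment by auto
  qed
  have s: "t * \<rho> = 4 * L * \<epsilon> * DIM('a)" using \<open>\<rho> > 0\<close> by (simp add: t_def \<theta>)
  have s': "t * \<rho> > 0" "4 * L * \<epsilon> * DIM('a) \<le> t * \<rho>" using mult_pos_pos[OF t(1) \<open>\<rho> > 0\<close>] s by (simp_all only: order_refl)
  obtain q0 q where q: "q0 \<in> U" "\<phi> q0 \<in> X" "norm (q0 - p) \<le> L * \<epsilon>"
    "\<And>b. b \<in> Basis \<Longrightarrow> q b \<in> U \<and> \<phi> (q b) \<in> X \<and> norm (q b - p) \<le> t * \<rho> + L * \<epsilon>"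
    "\<And>c::'a. t * \<rho> / 2 * norm c \<le> norm (\<Sum>b\<in>Basis. (c \<bullet> b) *\<^sub>R (q b - q0))"
    using well_conditioned_anchors[OF ball' s' cover X] by blast
  have p0U: "p0 \<in> U" using ball \<open>\<rho> > 0\<close> by auto
  have "norm (p0 - u) \<le> diameter U"
    using diameter_bounded_bound[OF compact_imp_bounded[OF compact] p0U u(1)] by (simp add: dist_norm)
  then have pu: "norm (p - u) \<le> t * diameter U" using t by (simp add: p_def)
  have B_eq: "B * \<epsilon> = t * diameter U + t * \<rho> + L * \<epsilon>" by (simp add: B t_def algebra_simps)
  have near: "norm (w - u) \<le> B * \<epsilon>" if "norm (w - p) \<le> t * \<rho> + L * \<epsilon>" for w
    using that pu norm_triangle_ineq[of "w - p" "p - u"] by (simp add: B_eq)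
  have q0u: "norm (q0 - u) \<le> B * \<epsilon>" using q(3) t \<open>\<rho> > 0\<close> by (intro near add_increasing) auto
  have qbu: "norm (q b - u) \<le> B * \<epsilon>" if "b \<in> Basis" for b using q(4)[OF that] near by blast
  have rem: "norm (\<phi> w - \<phi> u - D u (w - u)) \<le> K * (B * \<epsilon>)\<^sup>2" if "w \<in> U" "norm (w - u) \<le> B * \<epsilon>" for w
    by (intro order_trans[OF taylor[OF u(1) that(1)]] mult_left_mono power_mono that(2)) (use K_pos in auto)
  \<comment> \<open>Passing to the surface costs a Taylor error of order \<epsilon>^2, which
    \<open>small(2)\<close> limits to half of the lower bound in the parameter domain.\<close>
  have "L * DIM('a) * \<epsilon> * norm c \<le> norm (\<Sum>b\<in>Basis. (c \<bullet> b) *\<^sub>R (\<phi> (q b) - \<phi> q0))" for c :: 'a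
  proof -
    let ?S = "\<Sum>b\<in>Basis. (c \<bullet> b) *\<^sub>R (q b - q0)"
    let ?e = "\<Sum>b\<in>Basis. (c \<bullet> b) *\<^sub>R ((\<phi> (q b) - \<phi> q0) - D u (q b - q0))"
    have "norm ((\<phi> (q b) - \<phi> q0) - D u (q b - q0)) \<le> 2 * (K * (B * \<epsilon>)\<^sup>2)" if b: "b \<in> Basis" for b
    proof -
      have e: "(\<phi> (q b) - \<phi> q0) - D u (q b - q0) =
        (\<phi> (q b) - \<phi> u - D u (q b - u)) - (\<phi> q0 - \<phi> u - D u (q0 - u))"
        by (simp add: blinfun.diff_right)
      have "norm (\<phi> (q b) - \<phi> u - D u (q b - u)) \<le> K * (B * \<epsilon>)\<^sup>2"
        "norm (\<phi> q0 - \<phi> u - D u (q0 - u)) \<le> K * (B * \<epsilon>)\<^sup>2"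
        using q(1) q(4)[OF b] q0u qbu[OF b] by (auto intro!: rem)
      then show ?thesis
        unfolding e using norm_triangle_ineq4[of "\<phi> (q b) - \<phi> u - D u (q b - u)"
          "\<phi> q0 - \<phi> u - D u (q0 - u)"] by linarith
    qed
    then have "norm ?e \<le> (\<Sum>b\<in>(Basis::'a set). norm c * (2 * (K * (B * \<epsilon>)\<^sup>2)))"
      by (intro sum_norm_le) (auto intro!: mult_mono Basis_le_norm)
    also have "\<dots> = DIM('a) * norm c * \<epsilon> * (2 * K * B\<^sup>2 * \<epsilon>)" by (simp add: power2_eq_square mult_ac)
    also have "\<dots> \<le> DIM('a) * norm c * \<epsilon> * L"
      using small(2) \<open>\<epsilon> > 0\<close> by (intro mult_left_mono) auto
    finally have e: "norm ?e \<le> L * DIM('a) * \<epsilon> * norm c" by (simp add: mult_ac)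
    have "D u ?S = (\<Sum>b\<in>Basis. (c \<bullet> b) *\<^sub>R D u (q b - q0))"
      by (simp add: blinfun.sum_right blinfun.scaleR_right)
    then have "(\<Sum>b\<in>Basis. (c \<bullet> b) *\<^sub>R (\<phi> (q b) - \<phi> q0)) = D u ?S + ?e"
      by (simp add: scaleR_diff_right sum_subtractf)
    moreover have "2 * (L * DIM('a) * \<epsilon> * norm c) \<le> norm (D u ?S)"
      using q(5)[of c] unfolding norm_D[OF u(1)] s by (simp add: mult_ac)
    ultimately show ?thesis using e norm_triangle_ineq4[of "D u ?S + ?e" ?e] by simp
  qed
  moreover have "norm (\<phi> q0 - x) \<le> B * \<epsilon>" "\<And>b. b \<in> Basis \<Longrightarrow> norm (\<phi> (q b) - x) \<le> B * \<epsilon>"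
    using norm_chord[OF u(1)] q(1,4) q0u qbu unfolding u(2) by (meson order_trans)+
  ultimately show ?thesis using q(2,4) by (intro bexI[of _ "\<phi> q0"] exI[of _ "\<lambda>b. \<phi> (q b)"]) auto
qed

end

section \<open>Proof of the theorem\<close>

lemma (in regular_chart) rolling_chart_of_reach:
  assumes "ennreal R \<le> reach (\<phi> ` U)" "0 < r" "r < R"
  shows "rolling_chart U \<phi> D K L r"
  using assms by unfold_locales (auto intro: polar_touching_ball)

section \<open>Comparing charts of one surface\<close>

lemma isometric_chart_inv_into:
  assumes "isometric_chart U \<phi> S" "x \<in> S"
  shows "inv_into U \<phi> x \<in> U" "\<phi> (inv_into U \<phi> x) = x"
  using assms by (auto simp: isometric_chart_def inv_into_into f_inv_into_f)

lemma isometric_chart_dist_unique: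
  assumes "isometric_chart U \<phi> S" "isometric_chart V \<psi> S" "x \<in> S" "y \<in> S"
  shows "dist (inv_into U \<phi> x) (inv_into U \<phi> y) = dist (inv_into V \<psi> x) (inv_into V \<psi> y)"
proof -
  have "ennreal (dist (inv_into U \<phi> x) (inv_into U \<phi> y)) = intrinsic_dist S x y"
    "ennreal (dist (inv_into V \<psi> x) (inv_into V \<psi> y)) = intrinsic_dist S x y"
    using assms isometric_chart_inv_into[OF assms(1)] isometric_chart_inv_into[OF assms(2)]
    unfolding isometric_chart_def by metis+
  then have "ennreal (dist (inv_into U \<phi> x) (inv_into U \<phi> y)) = ennreal (dist (inv_into V \<psi> x) (inv_into V \<psi> y))"
    by simp
  then show ?thesis by simp
qed

text \<open>Both domains carry the intrinsic distance of \<open>S\<close>, so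
  \<open>procrustes\<close> applies with \<open>\<delta> = 0\<close>. This allows the constant in
  the theorem to be built from one chart and used for all.\<close>

lemma isometric_charts_congruent:
  fixes \<phi> \<psi> :: "real^'k \<Rightarrow> real^'d"
  assumes U: "isometric_chart U \<phi> S" and V: "isometric_chart V \<psi> S"
  obtains f t where "orthogonal_transformation f"
    "\<And>x. x \<in> S \<Longrightarrow> inv_into V \<psi> x = f (inv_into U \<phi> x) + t"
proof -
  obtain p where "p \<in> interior U" using U by (auto simp: isometric_chart_def)
  then obtain \<rho> where \<rho>: "\<rho> > 0" "cball p \<rho> \<subseteq> U" using mem_interior_cball by blast
  have compact: "compact U" and S: "\<phi> ` U = S" using U by (auto simp: isometric_chart_def)
  have inv: "inv_into U \<phi> (\<phi> u) = u" if "u \<in> U" for u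
    using inv_into_f_f[OF isometric_chart_inj_on[OF U] that] .
  have pU: "p \<in> U" and bU: "\<And>b. b \<in> Basis \<Longrightarrow> p + \<rho> *\<^sub>R b \<in> U"
    using \<rho> by (auto simp: dist_norm subset_iff)
  let ?a = "\<lambda>b. \<phi> (p + \<rho> *\<^sub>R b)"
  obtain C where C: "\<forall>(J::(real^'d) set) (u::real^'d \<Rightarrow> real^'k) (v::real^'d \<Rightarrow> real^'k) \<delta> i0 (a :: real^'k \<Rightarrow> real^'d).
     0 \<le> \<delta> \<and> C * \<delta> \<le> 1 \<and>
     (\<forall>i\<in>J. \<forall>j\<in>J. \<bar>dist (v i) (v j) - dist (u i) (u j)\<bar> \<le> \<delta>) \<and>
     (\<forall>i\<in>J. \<forall>j\<in>J. dist (u i) (u j) \<le> diameter U) \<and> i0 \<in> J \<and> (\<forall>b\<in>Basis. a b \<in> J) \<and>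
     (\<forall>c::real^'k. \<rho> * norm c \<le> norm (\<Sum>b\<in>Basis. (c \<bullet> b) *\<^sub>R (u (a b) - u i0))) \<longrightarrow>
     (\<exists>f t. orthogonal_transformation f \<and> (\<forall>i\<in>J. norm (v i - (f (u i) + t)) \<le> C * \<delta>))"
    using procrustes[OF \<rho>(1) diameter_ge_0[OF compact_imp_bounded[OF compact]], where 'i="real^'d"] by auto
  have "\<rho> * norm c \<le> norm (\<Sum>b\<in>Basis. (c \<bullet> b) *\<^sub>R (inv_into U \<phi> (?a b) - inv_into U \<phi> (\<phi> p)))" for c :: "real^'k"
  proof -
    have "(\<Sum>b\<in>Basis. (c \<bullet> b) *\<^sub>R (inv_into U \<phi> (?a b) - inv_into U \<phi> (\<phi> p))) = (\<Sum>b\<in>Basis. (c \<bullet> b) *\<^sub>R (\<rho> *\<^sub>R b))"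
      by (intro sum.cong refl) (simp add: inv pU bU)
    also have "\<dots> = \<rho> *\<^sub>R c" using euclidean_representation[of "\<rho> *\<^sub>R c"] by (simp add: mult.commute)
    finally show ?thesis using \<rho>(1) by simp
  qed
  moreover have "dist (inv_into U \<phi> x) (inv_into U \<phi> y) \<le> diameter U" if "x \<in> S" "y \<in> S" for x y
    using that isometric_chart_inv_into(1)[OF U] by (intro diameter_bounded_bound compact_imp_bounded compact)
  ultimately have "\<exists>f t. orthogonal_transformation f \<and> (\<forall>x\<in>S. norm (inv_into V \<psi> x - (f (inv_into U \<phi> x) + t)) \<le> C * 0)"
    using isometric_chart_dist_unique[OF U V] pU bU S
    by (intro C[rule_format, where ?i0.0="\<phi> p" and a="?a"]) auto
  then show thesis using that by auto
qed

text \<open>All constants are taken from one chart of \<open>M\<close>; the bound on the reach of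
  \<open>M'\<close> enters through the common radius \<open>r\<close>.\<close>

lemma quantitative_closeness:
  fixes \<phi> :: "real^'k \<Rightarrow> real^'d"
  assumes chart: "isometric_chart U \<phi> M"
  obtains C where "C > 0" "\<And>\<epsilon> X M' U' (\<phi>' :: real^'k \<Rightarrow> real^'d). 0 < \<epsilon> \<Longrightarrow> \<epsilon> \<le> 1 / C \<Longrightarrow>
    eps_covering \<epsilon> X M \<Longrightarrow> eps_covering \<epsilon> X M' \<Longrightarrow> reach M / 2 \<le> reach M' \<Longrightarrow> isometric_chart U' \<phi>' M' \<Longrightarrow>
    \<exists>f t. orthogonal_transformation f \<and>
      (\<forall>x\<in>X. norm (inv_into U' \<phi>' x - (f (inv_into U \<phi> x) + t)) \<le> C * \<epsilon>\<^sup>2)"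
proof -
  obtain D K L where "regular_chart U \<phi> D K L" using isometric_chart_regular[OF chart] .
  then interpret regular_chart U \<phi> D K L .
  have S: "\<phi> ` U = M" using chart by (simp add: isometric_chart_def)
  obtain p where "p \<in> interior U" using chart by (auto simp: isometric_chart_def)
  then obtain \<rho> where \<rho>: "\<rho> > 0" "cball p \<rho> \<subseteq> U" using mem_interior_cball by blast
  define k where "k = real DIM(real^'k)"
  have k: "k > 0" using DIM_positive[where 'a="real^'k"] by (simp add: k_def)
  define R0 where "R0 = 1 / (2 * K * L\<^sup>2)"
  \<comment> \<open>Touching balls are available for radii strictly below a bound for the reach, and
    for \<open>M'\<close> that bound is \<open>R0 / 2\<close>.\<close>
  define r where "r = R0 / 4"
  have R0: "R0 > 0" using K_pos L_pos by (simp add: R0_def)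
  have r: "r > 0" "r < R0" "r < R0 / 2" using R0 by (auto simp: r_def)
  have reach_M: "ennreal R0 \<le> reach M" using reach_ge S by (simp add: R0_def)
  have R1: "rolling_chart U \<phi> D K L r" using rolling_chart_of_reach[of R0 r] reach_M S r by simp
  define d where "d = diameter U"
  have d: "d \<ge> 0" using diameter_ge_0[OF compact_imp_bounded[OF compact]] by (simp add: d_def)
  define \<theta> where "\<theta> = 4 * L * k / \<rho>"
  define B where "B = \<theta> * (d + \<rho>) + L"
  define \<mu> where "\<mu> = L * k"
  have pos: "\<theta> > 0" "B > 0" "\<mu> > 0"
    using L_pos k \<rho>(1) d by (auto simp: \<theta>_def B_def \<mu>_def intro!: add_nonneg_pos)
  define \<kappa>0 where "\<kappa>0 = (B + 2)\<^sup>2 / r\<^sup>2 * (1 + 4 * (B + 2) * k / \<mu>)"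
  have \<kappa>0: "\<kappa>0 > 0" using pos r k by (auto simp: \<kappa>0_def intro!: mult_pos_pos divide_pos_pos add_pos_pos)
  obtain CP where CP: "CP > 0" and procr: "\<forall>(J::(real^'d) set) (u::real^'d \<Rightarrow> real^'k) (v::real^'d \<Rightarrow> real^'k) \<delta> i0 (a :: real^'k \<Rightarrow> real^'d).
     0 \<le> \<delta> \<and> CP * \<delta> \<le> 1 \<and>
     (\<forall>i\<in>J. \<forall>j\<in>J. \<bar>dist (v i) (v j) - dist (u i) (u j)\<bar> \<le> \<delta>) \<and>
     (\<forall>i\<in>J. \<forall>j\<in>J. dist (u i) (u j) \<le> d) \<and> i0 \<in> J \<and> (\<forall>b\<in>Basis. a b \<in> J) \<and>
     (\<forall>c::real^'k. \<rho> / 2 * norm c \<le> norm (\<Sum>b\<in>Basis. (c \<bullet> b) *\<^sub>R (u (a b) - u i0))) \<longrightarrow>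
     (\<exists>f t. orthogonal_transformation f \<and> (\<forall>i\<in>J. norm (v i - (f (u i) + t)) \<le> CP * \<delta>))"
    using procrustes[OF half_gt_zero[OF \<rho>(1)] d, where 'i="real^'d"] by auto
  \<comment> \<open>Each summand \<open>A\<close> turns one smallness condition into
    \<open>A * \<epsilon> \<le> 1\<close>; the last one is also the factor of
    \<open>\<epsilon>\<^sup>2\<close> in the conclusion.\<close>
  define C where "C = 1 + \<theta> + 2 * K * B\<^sup>2 / L + 4 * L * k / \<rho> + 2 / r + 2 * k * (B + 2)\<^sup>2 / (\<mu> * r)
    + 2 * \<kappa>0 + CP * (2 * \<kappa>0 * d)"
  have terms: "0 \<le> \<theta>" "0 \<le> 2 * K * B\<^sup>2 / L" "0 \<le> 4 * L * k / \<rho>" "0 \<le> 2 / r"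
    "0 \<le> 2 * k * (B + 2)\<^sup>2 / (\<mu> * r)" "0 \<le> 2 * \<kappa>0" "0 \<le> CP * (2 * \<kappa>0 * d)"
    using pos K_pos L_pos k r \<rho>(1) \<kappa>0 CP d by auto
  have C_ge: "1 \<le> C" "\<theta> \<le> C" "2 * K * B\<^sup>2 / L \<le> C" "4 * L * k / \<rho> \<le> C" "2 / r \<le> C"
    "2 * k * (B + 2)\<^sup>2 / (\<mu> * r) \<le> C" "2 * \<kappa>0 \<le> C" "CP * (2 * \<kappa>0 * d) \<le> C"
    using terms unfolding C_def by linarith+
  show thesis
  proof (rule that)
    show "C > 0" using C_ge(1) by linarith
    fix \<epsilon> :: real and X M' :: "(real^'d) set" and U' and \<phi>' :: "real^'k \<Rightarrow> real^'d"
    assume \<epsilon>: "0 < \<epsilon>" "\<epsilon> \<le> 1 / C" and cov: "eps_covering \<epsilon> X M" and cov': "eps_covering \<epsilon> X M'"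
      and reach: "reach M / 2 \<le> reach M'" and chart': "isometric_chart U' \<phi>' M'"
    have C\<epsilon>: "C * \<epsilon> \<le> 1" using \<epsilon> \<open>C > 0\<close> by (simp add: field_simps)
    have le: "A * \<epsilon> \<le> 1" if "A \<le> C" for A
      using mult_right_mono[OF that, of \<epsilon>] C\<epsilon> \<epsilon>(1) by linarith
    have \<epsilon>1: "\<epsilon> \<le> 1" using le[OF C_ge(1)] by simp
    have "\<epsilon>\<^sup>2 \<le> \<epsilon>" using \<epsilon>1 \<epsilon>(1) by (simp add: power2_eq_square)
    then have le2: "A * \<epsilon>\<^sup>2 \<le> 1" if "A \<le> C" "0 \<le> A" for A
      using mult_left_mono[OF \<open>\<epsilon>\<^sup>2 \<le> \<epsilon>\<close> that(2)] le[OF that(1)] by linarith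
    have s1: "\<theta> * \<epsilon> \<le> 1" by (rule le) (rule C_ge)
    have s2: "2 * K * B\<^sup>2 * \<epsilon> \<le> L"
      using le[OF C_ge(3)] L_pos by (simp add: field_simps)
    have s3: "4 * L * \<epsilon> * k \<le> \<rho>"
      using le[OF C_ge(4)] \<rho>(1) by (simp add: field_simps)
    have s4: "\<epsilon> \<le> r / 2" using le[OF C_ge(5)] r by (simp add: field_simps)
    have s5: "\<epsilon> * (2 * k * (B + 2)\<^sup>2) \<le> \<mu> * r"
      using le[OF C_ge(6)] mult_pos_pos[OF pos(3) r(1)] by (simp add: pos_divide_le_eq mult.commute)
    define \<kappa> where "\<kappa> = \<kappa>0 * \<epsilon>\<^sup>2"
    have \<kappa>: "0 \<le> \<kappa>" "\<kappa> \<le> 1 / 2"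
      using le2[OF C_ge(7)] \<kappa>0 by (auto simp: \<kappa>_def)
    have s7: "CP * (2 * \<kappa> * d) \<le> 1"
      using le2[OF C_ge(8)] terms(7) by (simp add: \<kappa>_def mult_ac)
    obtain D' K' L' where "regular_chart U' \<phi>' D' K' L'" using isometric_chart_regular[OF chart'] .
    then interpret c': regular_chart U' \<phi>' D' K' L' .
    have S': "\<phi>' ` U' = M'" using chart' by (simp add: isometric_chart_def)
    have "ennreal (R0 / 2) = ennreal R0 / 2" using R0 by (simp add: ennreal_divide_numeral)
    also have "\<dots> \<le> reach M / 2" using reach_M by (rule divide_right_mono_ennreal)
    also note reach
    finally have R2: "rolling_chart U' \<phi>' D' K' L' r"
      using c'.rolling_chart_of_reach[of "R0 / 2" r] S' r by simp
    have X: "X \<subseteq> \<phi> ` U" "X \<subseteq> \<phi>' ` U'" using cov cov' S S' by (auto simp: eps_covering_def)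
    have cover: "\<exists>x\<in>X. dist z x \<le> \<epsilon>" if "z \<in> \<phi> ` U" for z
      using cov that S by (auto simp: eps_covering_def)
    have cover': "\<exists>x\<in>X. dist z x \<le> \<epsilon>" if "z \<in> \<phi>' ` U'" for z
      using cov' that S' by (auto simp: eps_covering_def)
    have wc: "\<exists>y0\<in>X. \<exists>y. norm (y0 - x) \<le> B * \<epsilon> \<and>
       (\<forall>b\<in>Basis. y b \<in> X \<and> norm (y b - x) \<le> B * \<epsilon>) \<and>
       (\<forall>c::real^'k. \<mu> * \<epsilon> * norm c \<le> norm (\<Sum>b\<in>Basis. (c \<bullet> b) *\<^sub>R (y b - y0)))" if "x \<in> X" for x
      unfolding \<mu>_def k_def
      by (rule local_well_conditioned_anchors[OF \<rho>(2,1) \<epsilon>(1) cover X(1) _ _ s1 s2 that])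
        (simp_all add: \<theta>_def B_def d_def k_def)
    let ?u = "inv_into U \<phi>" and ?v = "inv_into U' \<phi>'"
    have u: "?u x \<in> U" "\<phi> (?u x) = x" and v: "?v x \<in> U'" "\<phi>' (?v x) = x" if "x \<in> X" for x
      using isometric_chart_inv_into[OF chart] isometric_chart_inv_into[OF chart'] that X S S' by auto
    have d_le: "dist (?u x) (?u y) \<le> d" if "x \<in> X" "y \<in> X" for x y
      unfolding d_def by (intro diameter_bounded_bound compact_imp_bounded compact u that)
    have \<kappa>_eq: "\<kappa> = (B + 2)\<^sup>2 / r\<^sup>2 * (1 + 4 * (B + 2) * real DIM(real^'k) / \<mu>) * \<epsilon>\<^sup>2" "\<kappa> < 1"
      using \<kappa>(2) by (simp only: \<kappa>_def \<kappa>0_def k_def, linarith)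
    have close: "\<bar>dist (?v x) (?v y) - dist (?u x) (?u y)\<bar> \<le> 2 * \<kappa> * d" if x: "x \<in> X" "y \<in> X" for x y
    proof -
      have 1: "(1 - \<kappa>) * dist (?v x) (?v y) \<le> dist (?u x) (?u y)"
        by (rule intrinsic_dist_comparison[OF R1 R2 X cover wc pos(2,3) \<epsilon>(1) s4 s5[unfolded k_def] \<kappa>_eq])
          (use x u v in auto)
      \<comment> \<open>The roles are exchanged, but the frames stay those found on
        \<open>M\<close>, since they consist of points of \<open>X\<close>.\<close>
      have 2: "(1 - \<kappa>) * dist (?u x) (?u y) \<le> dist (?v x) (?v y)"
        by (rule intrinsic_dist_comparison[OF R2 R1 X(2,1) cover' wc pos(2,3) \<epsilon>(1) s4 s5[unfolded k_def] \<kappa>_eq])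
          (use x u v in auto)
      \<comment> \<open>The diameter of \<open>U'\<close> is not known in advance; with
        \<open>\<kappa> \<le> 1 / 2\<close> the first comparison bounds the distances in
        \<open>U'\<close> between parameters of points of \<open>X\<close>.\<close>
      have "(1 / 2) * dist (?v x) (?v y) \<le> (1 - \<kappa>) * dist (?v x) (?v y)"
        using \<kappa> by (intro mult_right_mono) auto
      then have "dist (?v x) (?v y) \<le> 2 * d" using 1 d_le[OF x] by linarith
      then have "\<kappa> * dist (?v x) (?v y) \<le> \<kappa> * (2 * d)" using \<kappa> by (intro mult_left_mono)
      moreover have "\<kappa> * dist (?u x) (?u y) \<le> \<kappa> * (2 * d)"
        using \<kappa> d_le[OF x] d by (intro mult_left_mono) auto
      ultimately show ?thesis using 1 2 by (simp add: algebra_simps abs_le_iff)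
    qed
    \<comment> \<open>Here the frame has the fixed size \<open>\<rho>\<close>: the constant of
      \<open>procrustes\<close> would degenerate for frames of size \<epsilon>.\<close>
    obtain q0 q where q: "q0 \<in> U" "\<phi> q0 \<in> X" "norm (q0 - p) \<le> L * \<epsilon>"
      "\<And>b. b \<in> Basis \<Longrightarrow> q b \<in> U \<and> \<phi> (q b) \<in> X \<and> norm (q b - p) \<le> \<rho> + L * \<epsilon>"
      "\<And>c::real^'k. \<rho> / 2 * norm c \<le> norm (\<Sum>b\<in>Basis. (c \<bullet> b) *\<^sub>R (q b - q0))"
      using well_conditioned_anchors[OF \<rho>(2,1) s3[unfolded k_def] cover X(1)] by blast
    have inv: "?u (\<phi> w) = w" if "w \<in> U" for w
      using inv_into_f_f[OF inj_on_chart that] .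
    have anchors: "\<rho> / 2 * norm c \<le> norm (\<Sum>b\<in>Basis. (c \<bullet> b) *\<^sub>R (?u (\<phi> (q b)) - ?u (\<phi> q0)))" for c :: "real^'k"
    proof -
      have "(\<Sum>b\<in>Basis. (c \<bullet> b) *\<^sub>R (?u (\<phi> (q b)) - ?u (\<phi> q0))) = (\<Sum>b\<in>Basis. (c \<bullet> b) *\<^sub>R (q b - q0))"
        using q by (intro sum.cong refl) (simp add: inv)
      then show ?thesis using q(5)[of c] by simp
    qed
    have "\<exists>f t. orthogonal_transformation f \<and> (\<forall>x\<in>X. norm (?v x - (f (?u x) + t)) \<le> CP * (2 * \<kappa> * d))"
      by (rule procr[rule_format, where ?i0.0="\<phi> q0" and a="\<lambda>b. \<phi> (q b)"])
        (intro conjI ballI allI, use \<kappa> d s7 close d_le q anchors in auto)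
    moreover have "CP * (2 * \<kappa> * d) \<le> C * \<epsilon>\<^sup>2"
    proof -
      have "CP * (2 * \<kappa>0 * d) * \<epsilon>\<^sup>2 \<le> C * \<epsilon>\<^sup>2"
        by (intro mult_right_mono C_ge) auto
      then show ?thesis by (simp add: \<kappa>_def mult_ac)
    qed
    ultimately show "\<exists>f t. orthogonal_transformation f \<and> (\<forall>x\<in>X. norm (?v x - (f (?u x) + t)) \<le> C * \<epsilon>\<^sup>2)"
      using order_trans by blast
  qed
qed

theorem theorem5p2:
  fixes M :: "(real^'d) set"
  assumes "condition_I TYPE('k::finite) M"
  shows "\<exists>C>0. \<forall>(U :: (real^'k) set) (\<phi> :: real^'k \<Rightarrow> real^'d).
    isometric_chart U \<phi> M \<longrightarrow>
    (\<forall>\<epsilon>::real. 0 < \<epsilon> \<and> \<epsilon> \<le> 1 / C \<longrightarrow>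
      (\<forall>(n::nat) (x :: nat \<Rightarrow> real^'d) X.
        X = x ` {1..n} \<and> eps_covering \<epsilon> X M \<longrightarrow>
        (\<forall>M' \<in> surface_class TYPE('k) X \<epsilon>.
          reach M' \<ge> reach_max TYPE('k) X \<epsilon> / 2 \<and>
          cone_constant M' \<ge> cone_max TYPE('k) X \<epsilon> / 2 \<longrightarrow>
          (\<forall>(U' :: (real^'k) set) (\<phi>' :: real^'k \<Rightarrow> real^'d).
            isometric_chart U' \<phi>' M' \<longrightarrow>
            (\<exists>Q \<in> rigid_transformations. \<forall>i\<in>{1..n}.
               norm (inv_into U' \<phi>' (x i) - Q (inv_into U \<phi> (x i))) \<le> C * \<epsilon>\<^sup>2)))))"
proof -
  obtain U0 and \<phi>0 :: "real^'k \<Rightarrow> real^'d" where chart0: "isometric_chart U0 \<phi>0 M"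
    using assms by (auto simp: condition_I_def)
  obtain C where "C > 0" and main: "\<And>\<epsilon> X M' U' (\<phi>' :: real^'k \<Rightarrow> real^'d). 0 < \<epsilon> \<Longrightarrow> \<epsilon> \<le> 1 / C \<Longrightarrow>
    eps_covering \<epsilon> X M \<Longrightarrow> eps_covering \<epsilon> X M' \<Longrightarrow> reach M / 2 \<le> reach M' \<Longrightarrow> isometric_chart U' \<phi>' M' \<Longrightarrow>
    \<exists>f t. orthogonal_transformation f \<and>
      (\<forall>x\<in>X. norm (inv_into U' \<phi>' x - (f (inv_into U0 \<phi>0 x) + t)) \<le> C * \<epsilon>\<^sup>2)"
    using quantitative_closeness[OF chart0] by blast
  show ?thesis
  proof (intro exI[of _ C] conjI \<open>C > 0\<close> allI impI ballI, elim conjE)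
    fix U \<phi> \<epsilon> n and x :: "nat \<Rightarrow> real^'d" and X M' U' and \<phi>' :: "real^'k \<Rightarrow> real^'d"
    assume chart: "isometric_chart U (\<phi> :: real^'k \<Rightarrow> real^'d) M" and chart': "isometric_chart U' \<phi>' M'"
      and M': "M' \<in> surface_class TYPE('k) X \<epsilon>" and \<epsilon>: "0 < \<epsilon>" "\<epsilon> \<le> 1 / C"
      and reach: "reach_max TYPE('k) X \<epsilon> / 2 \<le> reach M'"
      and X: "X = x ` {1..n}" and cov: "eps_covering \<epsilon> X M"
    \<comment> \<open>\<open>M\<close> is itself a competitor in the supremum, which gives the lower
      bound on the reach of \<open>M'\<close>.\<close>
    have "M \<in> surface_class TYPE('k) X \<epsilon>"
      using assms cov by (auto simp: surface_class_def eps_covering_def)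
    then have "reach M \<le> reach_max TYPE('k) X \<epsilon>" unfolding reach_max_def by (rule SUP_upper)
    then have "reach M / 2 \<le> reach M'" using reach divide_right_mono_ennreal order_trans by blast
    moreover have "eps_covering \<epsilon> X M'" using M' by (simp add: surface_class_def)
    ultimately obtain f t where f: "orthogonal_transformation f"
      and close: "\<And>x. x \<in> X \<Longrightarrow> norm (inv_into U' \<phi>' x - (f (inv_into U0 \<phi>0 x) + t)) \<le> C * \<epsilon>\<^sup>2"
      using main[OF \<epsilon> cov _ _ chart'] by blast
    \<comment> \<open>\<open>C\<close> was built from the chart \<open>\<phi>0\<close>, while
      \<open>\<phi>\<close> is arbitrary; the two parametrisations differ by a rigid transformation,
      which is absorbed in \<open>?Q\<close>.\<close>
    obtain g s where g: "orthogonal_transformation g"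
      and congr: "\<And>x. x \<in> M \<Longrightarrow> inv_into U0 \<phi>0 x = g (inv_into U \<phi> x) + s"
      using isometric_charts_congruent[OF chart chart0] by blast
    let ?Q = "\<lambda>u. (f \<circ> g) u + (f s + t)"
    have Q: "?Q \<in> rigid_transformations"
      unfolding rigid_transformations_def using orthogonal_transformation_compose[OF f g] by blast
    have "norm (inv_into U' \<phi>' (x i) - ?Q (inv_into U \<phi> (x i))) \<le> C * \<epsilon>\<^sup>2" if "i \<in> {1..n}" for i
    proof -
      have xi: "x i \<in> X" "x i \<in> M" using that X cov by (auto simp: eps_covering_def)
      have "linear f" using f by (simp add: orthogonal_transformation_def)
      then have "?Q (inv_into U \<phi> (x i)) = f (inv_into U0 \<phi>0 (x i)) + t"
        unfolding congr[OF xi(2)] by (simp add: linear_add add.assoc)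
      then show ?thesis using close[OF xi(1)] by (simp only:)
    qed
    then show "\<exists>Q \<in> rigid_transformations. \<forall>i\<in>{1..n}.
       norm (inv_into U' \<phi>' (x i) - Q (inv_into U \<phi> (x i))) \<le> C * \<epsilon>\<^sup>2"
      by (intro bexI[OF _ Q] ballI)
  qed
qed

end
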